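(* Let $\lambda\in(0,d)$. For all $p_1\in(1,\frac d\lambda)$, $q_1\in[p_1,\frac d\lambda)$, $p_2$ and $q_2$ satisfying \[ \frac1{p_1}-\frac1{p_2}=\frac1{q_1}-\frac1{q_2}=\frac\lambda d, \] and weights $v$ satisfying \[ \sup_Q|Q|^{-(1-\frac\lambda d-\frac1{p_1}+\frac1{q_1})}\|v\mathbf{1}_Q\|_{L^{q_2}(\mathbf{R}^d)}\|v^{-1}\mathbf{1}_Q\|_{L^{p_1'}(\mathbf{R}^d)}<\infty, \] we have \[ \|I_\lambda f\|_{\mathcal{L}^{p_2,q_2}_v(\mathbf{R}^d)}\lesssim_d\|f\|_{\mathcal{L}^{p_1,q_1}_v(\mathbf{R}^d)} \] for all $f\in L^{q_1}_v(\mathbf{R}^d)$.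
   Context: $A\lesssim_d B$ means $A\leq C_dB$ for a constant $C_d$ depending only on the dimension $d$. A weight is a measurable function with $0<v<\infty$ a.e. $\frac1{p_1'}=1-\frac1{p_1}$. $\|f\|_{L^q_v}=\|fv\|_{L^q}$. $Q$ runs over cubes in $\mathbf{R}^d$ with sides parallel to the axes. The Riesz potential is $I_\lambda f(x)=\int_{\mathbf{R}^d}\frac{f(y)}{|x-y|^{d-\lambda}}\,dy$. The weighted Morrey space $\mathcal{L}^{p,q}_v(\mathbf{R}^d)$, $0<p\le q<\infty$, has quasi-norm $\|f\|_{\mathcal{L}^{p,q}_v}=\sup_Q|Q|^{1/q}\big(\frac1{|Q|}\int_Q|fv|^p\,dx\big)^{1/p}$.
   Formalization: The implied constant depends on d, λ, p_1, q_1 and the value of the supremum in the weight condition, not on d alone; with d alone the bound fails (v=1, p_1=q_1→1, f the indicator of the unit ball). *)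

theory Defs
  imports "HOL-Analysis.Analysis"
begin

text \<open>
  Euclidean space of dimension \<open>d\<close> is \<^typ>\<open>real^'d\<close>, with \<open>d = CARD('d)\<close>. ``Measurable'' means
  Lebesgue measurable, and quasi-norms take values in \<^typ>\<open>ennreal\<close>.
\<close>

text \<open>Real powers on \<open>[0, \<infinity>]\<close>, only meant for exponents \<open>a > 0\<close>.\<close>

definition epowr :: "ennreal \<Rightarrow> real \<Rightarrow> ennreal" where
  "epowr x a = (if x = \<infinity> then \<infinity> else ennreal (enn2real x powr a))"

definition cubes :: "(real^'d) set set" where
  "cubes = {cbox a (\<chi> i. a $ i + l) | a l. 0 < l}"

definition weight :: "(real^'d \<Rightarrow> real) \<Rightarrow> bool" where
  "weight v \<longleftrightarrow> v \<in> borel_measurable lebesgue \<and> (AE x in lebesgue. 0 < v x)"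

definition Lnorm :: "real \<Rightarrow> (real^'d \<Rightarrow> 'b::real_normed_vector) \<Rightarrow> ennreal" where
  "Lnorm q f = epowr (\<integral>\<^sup>+ x. ennreal (norm (f x) powr q) \<partial>lebesgue) (1 / q)"

text \<open>The weight acts as a multiplier: \<open>f\<close> lies in the weighted space iff \<open>v f\<close> lies in \<open>L\<^sup>q\<close>.\<close>

definition weighted_Lspace :: "real \<Rightarrow> (real^'d \<Rightarrow> real) \<Rightarrow> (real^'d \<Rightarrow> complex) set" where
  "weighted_Lspace q v = {f \<in> borel_measurable lebesgue. Lnorm q (\<lambda>x. v x *\<^sub>R f x) < \<infinity>}"

definition morrey_norm ::
    "real \<Rightarrow> real \<Rightarrow> (real^'d \<Rightarrow> real) \<Rightarrow> (real^'d \<Rightarrow> complex) \<Rightarrow> ennreal" where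
  "morrey_norm p q v f =
    (SUP Q\<in>cubes. ennreal (measure lebesgue Q powr (1 / q)) *
       epowr (ennreal (1 / measure lebesgue Q) *
         (\<integral>\<^sup>+ x\<in>Q. ennreal (norm (v x *\<^sub>R f x) powr p) \<partial>lebesgue)) (1 / p))"

definition riesz_kernel :: "real \<Rightarrow> real^'d \<Rightarrow> real^'d \<Rightarrow> real" where
  "riesz_kernel s x y = 1 / norm (x - y) powr (real CARD('d) - s)"

text \<open>
  The Bochner integral has the default value \<open>0\<close> where the integrand is not absolutely integrable,
  so statements about \<open>riesz_potential\<close> should also assert integrability almost everywhere.
\<close>

definition riesz_potential :: "real \<Rightarrow> (real^'d \<Rightarrow> complex) \<Rightarrow> real^'d \<Rightarrow> complex" where
  "riesz_potential s f x = (\<integral>y. riesz_kernel s x y *\<^sub>R f y \<partial>lebesgue)"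

text \<open>
  The supremum in the weight condition. The argument \<open>p1'\<close> is the conjugate exponent of \<open>p1\<close>.
\<close>

definition weight_const ::
    "real \<Rightarrow> real \<Rightarrow> real \<Rightarrow> real \<Rightarrow> real \<Rightarrow> (real^'d \<Rightarrow> real) \<Rightarrow> ennreal" where
  "weight_const s p1 p1' q1 q2 v =
    (SUP Q\<in>cubes.
       ennreal (measure lebesgue Q powr (- (1 - s / real CARD('d) - 1 / p1 + 1 / q1))) *
       Lnorm q2 (\<lambda>x. v x * indicator Q x) *
       Lnorm p1' (\<lambda>x. inverse (v x) * indicator Q x))"

end

theory Submission
  imports Defs
begin

text \<open>
  Write \<open>p = p\<^sub>1\<close> and \<open>q = p\<^sub>2\<close>. Fix a cube and split \<open>f\<close> into its parts inside and outside a ball about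
  the centre of the cube.

  The far part is elementary. Because of the relations between the exponents, the assumption on \<open>v\<close> is
  a Muckenhoupt condition for \<open>v\<close> to the power \<open>q\<^sub>2\<close> (\<open>cube_condition\<close>, \<open>Ap_weight_V\<close>). Decomposing
  the kernel into dyadic annuli and using Hoelder's inequality on each (\<open>ball_integral_le\<close>), the
  potential is bounded on the cube by a multiple of the Morrey norm of \<open>f\<close> times
  the sum, over the dilates of the ball, of the inverse \<open>L\<close>-norms of \<open>v\<close> with exponent \<open>q\<^sub>2\<close>. A
  Muckenhoupt weight satisfies a reverse doubling condition (\<open>reverse_doubling\<close>), so this sum is
  geometric (\<open>far_part\<close>).

  The local part is the weighted inequality of Muckenhoupt and Wheeden between weighted \<open>L\<^sup>p\<close> and \<open>L\<^sup>q\<close>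
  (\<open>Muckenhoupt_Wheeden\<close>, \<open>local_part\<close>), which is proved here without good-lambda inequalities, dyadic
  grids or reverse Hoelder inequalities, by a weighted form of Hedberg's argument. With \<open>w = v\<^sup>q\<close>, its
  measure \<open>W\<close>, and the dual weight \<open>\<sigma>\<close>, the dyadic pieces of the potential at a point \<open>x\<close> have two
  bounds in terms of the weight \<open>W(B)\<close> of the ball of the given radius about \<open>x\<close>. By Hoelder's
  inequality a piece is at most a constant times \<open>W(B)\<close> to the power \<open>-1/q\<close>, times the norm of \<open>f v\<close> in \<open>L\<^sup>p\<close>;
  and it is at most a constant times \<open>W(B)\<close> to the power \<open>1/p - 1/q\<close>, times a maximal function
  \<open>N(x)\<close>. Since \<open>W\<close> is reverse doubling, both bounds sum geometrically on either side of the scale where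
  they agree (\<open>Hedberg_splitting\<close>), and the potential is at most a constant times this norm to the
  power \<open>1 - p/q\<close> times \<open>N(x)\<close> to the power \<open>p/q\<close> (\<open>riesz_int_le_lerner\<close>).

  It remains to bound the norm of \<open>N\<close> in \<open>L\<^sup>p(W)\<close> by that of \<open>f v\<close> in \<open>L\<^sup>p\<close>. Following Lerner, \<open>N\<close> is a power of the
  composition of a maximal function for \<open>\<sigma>\<close> with one for \<open>W\<close> (\<open>lerner_strong_type\<close>). Both measures
  are doubling, and for a doubling measure the maximal function is bounded on every \<open>L\<^sup>r\<close> with
  \<open>r > 1\<close> by Vitali's covering lemma and interpolation (\<open>strong_type\<close>).
\<close>

section \<open>Powers and the Hoelder inequality on the extended half line\<close>

lemma epowr_top [simp]: "epowr \<infinity> a = \<infinity>" "epowr top a = top"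
  by (simp_all add: epowr_def)

lemma epowr_0 [simp]: "epowr 0 a = 0"
  by (simp add: epowr_def)

lemma epowr_ennreal: "0 \<le> x \<Longrightarrow> epowr (ennreal x) a = ennreal (x powr a)"
  by (simp add: epowr_def)

lemma epowr_one_right [simp]: "epowr x 1 = x"
  by (cases x) (auto simp: epowr_ennreal)

lemma epowr_one_left [simp]: "epowr 1 a = 1"
  using epowr_ennreal[of 1 a] by simp

lemma epowr_eq_0_iff [simp]: "epowr x a = 0 \<longleftrightarrow> x = 0"
  by (cases x) (auto simp: epowr_ennreal ennreal_eq_0_iff)

lemma epowr_eq_top_iff [simp]: "epowr x a = top \<longleftrightarrow> x = top"
  by (cases x) (auto simp: epowr_ennreal)

lemma epowr_less_top_iff [simp]: "epowr x a < top \<longleftrightarrow> x < top"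
  by (cases x) (auto simp: epowr_ennreal)

lemma epowr_mono: "0 < a \<Longrightarrow> x \<le> y \<Longrightarrow> epowr x a \<le> epowr y a"
  by (cases x; cases y) (auto simp: epowr_ennreal top_unique intro!: powr_mono2 ennreal_leI)

lemma epowr_mult: "epowr (x * y) a = epowr x a * epowr y a"
proof (cases x; cases y)
  fix r s assume "x = ennreal r" "0 \<le> r" "y = ennreal s" "0 \<le> s"
  then show ?thesis
    by (simp add: epowr_ennreal powr_mult flip: ennreal_mult)
qed (auto simp: ennreal_mult_top ennreal_top_mult epowr_ennreal ennreal_mult_eq_top_iff ennreal_eq_0_iff)

lemma epowr_epowr: "epowr (epowr x a) b = epowr x (a * b)"
  by (cases x) (auto simp: epowr_ennreal powr_powr)

lemma epowr_add: "epowr x (a + b) = epowr x a * epowr x b"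
  by (cases x) (auto simp: epowr_ennreal powr_add ennreal_mult)

lemma measurable_epowr [measurable]: "(\<lambda>x. epowr x a) \<in> borel_measurable borel"
  unfolding epowr_def by measurable

lemma epowr_double_le:
  assumes "0 < a" shows "epowr (x + y) a \<le> ennreal (2 powr a) * (epowr x a + epowr y a)"
proof -
  have "epowr (x + y) a \<le> epowr (2 * max x y) a"
    using assms by (intro epowr_mono) (auto simp: mult_2 intro: add_mono)
  also have "\<dots> = ennreal (2 powr a) * epowr (max x y) a"
    using epowr_ennreal[of 2 a] by (simp add: epowr_mult)
  also have "\<dots> \<le> ennreal (2 powr a) * (epowr x a + epowr y a)"
    by (intro mult_left_mono) (auto simp: max_def)
  finally show ?thesis .
qed

text \<open>Young's inequality with weights \<open>A\<close> and \<open>B\<close>; integrated, with the integrals of \<open>F\<close> and \<open>G\<close> as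
  weights, its right-hand side collapses to the right-hand side of Hoelder's inequality.\<close>

lemma epowr_Young:
  fixes F G :: ennreal and A B :: real
  assumes "0 < a" "a < 1" "0 < A" "0 < B"
  shows "epowr F a * epowr G (1 - a)
    \<le> ennreal (A powr a * B powr (1 - a)) * (ennreal (a / A) * F + ennreal ((1 - a) / B) * G)"
proof (cases F; cases G)
  fix f g assume fg: "F = ennreal f" "0 \<le> f" "G = ennreal g" "0 \<le> g"
  have "(f / A) powr a * (g / B) powr (1 - a) \<le> a * (f / A) + (1 - a) * (g / B)"
  proof (cases "f = 0 \<or> g = 0")
    case False
    then show ?thesis using assms fg by (intro Youngs_inequality_0) auto
  qed (use assms fg in auto)
  then have "(A powr a * B powr (1 - a)) * ((f / A) powr a * (g / B) powr (1 - a))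
      \<le> (A powr a * B powr (1 - a)) * (a * (f / A) + (1 - a) * (g / B))"
    by (intro mult_left_mono) auto
  moreover have "(A powr a * B powr (1 - a)) * ((f / A) powr a * (g / B) powr (1 - a)) =
      f powr a * g powr (1 - a)"
    using assms fg by (simp add: powr_divide)
  ultimately show ?thesis
    using assms fg
    by (simp add: epowr_ennreal flip: ennreal_mult ennreal_plus)
qed (use assms in \<open>auto simp: ennreal_mult_top ennreal_top_mult ennreal_mult_eq_top_iff
      ennreal_eq_0_iff not_le top_unique divide_le_0_iff mult_le_0_iff\<close>)

text \<open>The form with exponents \<open>a\<close> and \<open>1 - a\<close> treats both factors alike, and it suits weights,
  where a constant is split as \<open>w\<^sup>a w\<^sup>-\<^sup>a\<close>.\<close>

lemma nn_integral_Hoelder: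
  assumes [measurable]: "F \<in> borel_measurable M" "G \<in> borel_measurable M" and a: "0 < a" "a < 1"
  shows "(\<integral>\<^sup>+x. epowr (F x) a * epowr (G x) (1 - a) \<partial>M)
    \<le> epowr (\<integral>\<^sup>+x. F x \<partial>M) a * epowr (\<integral>\<^sup>+x. G x \<partial>M) (1 - a)"
proof -
  consider "(\<integral>\<^sup>+x. F x \<partial>M) = 0" | "(\<integral>\<^sup>+x. G x \<partial>M) = 0"
    | "(\<integral>\<^sup>+x. F x \<partial>M) \<noteq> 0" "(\<integral>\<^sup>+x. G x \<partial>M) \<noteq> 0" "(\<integral>\<^sup>+x. F x \<partial>M) = top \<or> (\<integral>\<^sup>+x. G x \<partial>M) = top"
    | A B where "(\<integral>\<^sup>+x. F x \<partial>M) = ennreal A" "(\<integral>\<^sup>+x. G x \<partial>M) = ennreal B" "0 < A" "0 < B"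
    by (cases "\<integral>\<^sup>+x. F x \<partial>M"; cases "\<integral>\<^sup>+x. G x \<partial>M")
       (auto simp: ennreal_eq_0_iff less_le)
  then show ?thesis
  proof cases
    case 1
    then have "AE x in M. F x = 0" by (simp add: nn_integral_0_iff_AE)
    then have "(\<integral>\<^sup>+x. epowr (F x) a * epowr (G x) (1 - a) \<partial>M) = (\<integral>\<^sup>+x. 0 \<partial>M)"
      by (intro nn_integral_cong_AE) auto
    then show ?thesis by simp
  next
    case 2
    then have "AE x in M. G x = 0" by (simp add: nn_integral_0_iff_AE)
    then have "(\<integral>\<^sup>+x. epowr (F x) a * epowr (G x) (1 - a) \<partial>M) = (\<integral>\<^sup>+x. 0 \<partial>M)"
      by (intro nn_integral_cong_AE) auto
    then show ?thesis by simp
  next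
    case 3
    then show ?thesis by (auto simp: ennreal_mult_top ennreal_top_mult ennreal_mult_eq_top_iff)
  next
    case (4 A B)
    have "(\<integral>\<^sup>+x. epowr (F x) a * epowr (G x) (1 - a) \<partial>M) \<le>
       (\<integral>\<^sup>+x. ennreal (A powr a * B powr (1 - a)) * (ennreal (a / A) * F x + ennreal ((1 - a) / B) * G x) \<partial>M)"
      using a 4 by (intro nn_integral_mono epowr_Young) auto
    also have "\<dots> = ennreal (A powr a * B powr (1 - a)) * (ennreal (a / A) * ennreal A + ennreal ((1 - a) / B) * ennreal B)"
      by (simp add: nn_integral_cmult nn_integral_add 4)
    also have "\<dots> = ennreal (A powr a * B powr (1 - a))"
      using a 4 by (simp flip: ennreal_mult ennreal_plus)
    finally show ?thesis using 4 a by (simp add: epowr_ennreal ennreal_mult)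
  qed
qed

section \<open>Maximal functions of doubling measures\<close>

lemma epowr_eq_nn_integral:
  assumes p: "0 < p"
  shows "epowr y p = (\<integral>\<^sup>+t. ennreal (p * t powr (p - 1)) * indicator {t. 0 < t \<and> ennreal t < y} t \<partial>lborel)"
proof -
  have fin: "(\<integral>\<^sup>+t. ennreal (p * t powr (p - 1)) * indicator {t. 0 < t \<and> ennreal t < ennreal c} t \<partial>lborel) = ennreal (c powr p)"
    if c: "0 \<le> c" for c
  proof -
    have "(\<integral>\<^sup>+t. ennreal (p * t powr (p - 1)) * indicator {t. 0 < t \<and> ennreal t < ennreal c} t \<partial>lborel)
       = (\<integral>\<^sup>+t. ennreal (p * t powr (p - 1)) * indicator {0..c} t \<partial>lborel)"
      using AE_lborel_singleton[of 0] AE_lborel_singleton[of c]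
      by (intro nn_integral_cong_AE, eventually_elim) (auto simp: indicator_def ennreal_less_iff)
    also have "\<dots> = ennreal (p * (c powr (p - 1 + 1) / (p - 1 + 1)))"
      using p c by (intro nn_integral_has_integral_lebesgue' has_integral_mult_right has_integral_powr_from_0) auto
    finally show ?thesis using p by simp
  qed
  show ?thesis
  proof (cases y)
    case (real c)
    then show ?thesis using fin[of c] by (simp add: epowr_ennreal)
  next
    case top
    have "ennreal c \<le> (\<integral>\<^sup>+t. ennreal (p * t powr (p - 1)) * indicator {t. 0 < t \<and> ennreal t < top} t \<partial>lborel)" (is "_ \<le> ?I")
      if "0 \<le> c" for c
    proof -
      have "ennreal c = ennreal ((c powr (1/p)) powr p)" using p that by (simp add: powr_powr)
      also have "\<dots> \<le> ?I"
        by (subst fin[symmetric]) (auto intro!: nn_integral_mono simp: indicator_def)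
      finally show ?thesis .
    qed
    note le = this
    have "?I = top"
    proof (cases ?I)
      case (real r)
      with le[of "r + 1"] show ?thesis by simp
    qed
    with top show ?thesis by simp
  qed
qed

lemma measurable_indicator_gt [measurable]:
  "(\<lambda>(x, t). indicator {t. 0 < t \<and> ennreal t < h x} t :: ennreal) \<in> borel_measurable (M \<Otimes>\<^sub>M lborel)"
  if [measurable]: "h \<in> borel_measurable M"
proof -
  have "(\<lambda>(x, t). indicator {t. 0 < t \<and> ennreal t < h x} t :: ennreal) =
     indicator {z. 0 < snd z \<and> ennreal (snd z) < h (fst z)}"
    by (auto simp: fun_eq_iff indicator_def)
  moreover have "Measurable.pred (M \<Otimes>\<^sub>M lborel) (\<lambda>z. 0 < snd z \<and> ennreal (snd z) < h (fst z))"
    by measurable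
  then have "{z \<in> space (M \<Otimes>\<^sub>M lborel). 0 < snd z \<and> ennreal (snd z) < h (fst z)} \<in> sets (M \<Otimes>\<^sub>M lborel)"
    by measurable
  then have "(indicator {z. 0 < snd z \<and> ennreal (snd z) < h (fst z)} :: _ \<Rightarrow> ennreal) \<in> borel_measurable (M \<Otimes>\<^sub>M lborel)"
    by (subst borel_measurable_indicator_iff) (simp add: Int_def conj_commute)
  ultimately show ?thesis by simp
qed

text \<open>The layer cake formula for \<open>\<integral> h\<^sup>p d(gM)\<close>. The factor \<open>g\<close> allows the formula to be applied a
  second time, backwards, in the interpolation argument below.\<close>

lemma nn_integral_mult_epowr:
  assumes "sigma_finite_measure M" and [measurable]: "g \<in> borel_measurable M" "h \<in> borel_measurable M" and p: "0 < p"
  shows "(\<integral>\<^sup>+x. g x * epowr (h x) p \<partial>M) =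
    (\<integral>\<^sup>+t. ennreal (p * t powr (p - 1)) * indicator {0<..} t * (\<integral>\<^sup>+x. g x * indicator {x. ennreal t < h x} x \<partial>M) \<partial>lborel)"
proof -
  interpret sigma_finite_measure M by fact
  interpret pair_sigma_finite M lborel ..
  have "(\<integral>\<^sup>+x. g x * epowr (h x) p \<partial>M) =
     (\<integral>\<^sup>+x. (\<integral>\<^sup>+t. g x * (ennreal (p * t powr (p - 1)) * indicator {t. 0 < t \<and> ennreal t < h x} t) \<partial>lborel) \<partial>M)"
  proof (intro nn_integral_cong)
    fix x assume [measurable]: "x \<in> space M"
    have "{t. 0 < t \<and> ennreal t < h x} \<in> sets lborel" by measurable
    then show "g x * epowr (h x) p = (\<integral>\<^sup>+t. g x * (ennreal (p * t powr (p - 1)) * indicator {t. 0 < t \<and> ennreal t < h x} t) \<partial>lborel)"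
      by (subst nn_integral_cmult) (auto simp: epowr_eq_nn_integral[OF p])
  qed
  also have "\<dots> = (\<integral>\<^sup>+t. (\<integral>\<^sup>+x. g x * (ennreal (p * t powr (p - 1)) * indicator {t. 0 < t \<and> ennreal t < h x} t) \<partial>M) \<partial>lborel)"
    by (rule Fubini'[symmetric]) measurable
  also have "\<dots> = (\<integral>\<^sup>+t. ennreal (p * t powr (p - 1)) * indicator {0<..} t * (\<integral>\<^sup>+x. g x * indicator {x. ennreal t < h x} x \<partial>M) \<partial>lborel)"
  proof (intro nn_integral_cong)
    fix t :: real
    have m: "(\<lambda>x. g x * indicator {x. ennreal t < h x} x) \<in> borel_measurable M"
    proof -
      have "(indicator {x. ennreal t < h x} :: _ \<Rightarrow> ennreal) \<in> borel_measurable M"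
        by (subst borel_measurable_indicator_iff) (simp add: Int_def conj_commute)
      then show ?thesis by measurable
    qed
    have "(\<integral>\<^sup>+x. g x * (ennreal (p * t powr (p - 1)) * indicator {t. 0 < t \<and> ennreal t < h x} t) \<partial>M) =
      (\<integral>\<^sup>+x. (ennreal (p * t powr (p - 1)) * indicator {0<..} t) * (g x * indicator {x. ennreal t < h x} x) \<partial>M)"
      by (intro nn_integral_cong) (auto simp: indicator_def mult_ac)
    also have "\<dots> = ennreal (p * t powr (p - 1)) * indicator {0<..} t * (\<integral>\<^sup>+x. g x * indicator {x. ennreal t < h x} x \<partial>M)"
      by (rule nn_integral_cmult[OF m])
    finally show "(\<integral>\<^sup>+x. g x * (ennreal (p * t powr (p - 1)) * indicator {t. 0 < t \<and> ennreal t < h x} t) \<partial>M) = \<dots>" .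
  qed
  finally show ?thesis .
qed

lemma measurable_tail_integral:
  assumes "sigma_finite_measure M" and [measurable]: "g \<in> borel_measurable M" "h \<in> borel_measurable M"
  shows "(\<lambda>t. \<integral>\<^sup>+x. g x * indicator {x. ennreal t < h x} x \<partial>M) \<in> borel_measurable borel"
proof -
  interpret sigma_finite_measure M by fact
  have "Measurable.pred (borel \<Otimes>\<^sub>M M) (\<lambda>z. ennreal (fst z) < h (snd z))"
    by measurable
  then have "(\<lambda>z. g (snd z) * (if ennreal (fst z) < h (snd z) then 1 else 0)) \<in> borel_measurable (borel \<Otimes>\<^sub>M M)"
    by measurable
  also have "(\<lambda>z. g (snd z) * (if ennreal (fst z) < h (snd z) then 1 else 0)) =
     case_prod (\<lambda>t x. g x * indicator {x. ennreal t < h x} x)"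
    by (auto simp: fun_eq_iff indicator_def)
  finally show ?thesis by (rule borel_measurable_nn_integral)
qed

text \<open>
  Balls are uncentred. Level sets are then unions of open balls, hence open whatever the measure
  is, and the value at any point of a ball dominates the average over the whole ball, which is what
  the pointwise comparison with weighted averages relies on.
\<close>

definition maximal :: "'a::euclidean_space measure \<Rightarrow> ('a \<Rightarrow> ennreal) \<Rightarrow> 'a \<Rightarrow> ennreal" where
  "maximal \<mu> g x = (SUP (z, r)\<in>{(z, r). x \<in> ball z r}.
     (\<integral>\<^sup>+y\<in>ball z r. g y \<partial>\<mu>) / emeasure \<mu> (ball z r))"

lemma maximal_level_set:
  "{x. t < maximal \<mu> g x} =
     (\<Union>(z, r)\<in>{(z, r). t < (\<integral>\<^sup>+y\<in>ball z r. g y \<partial>\<mu>) / emeasure \<mu> (ball z r)}. ball z r)"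
  by (auto simp: maximal_def less_SUP_iff) blast

lemma measurable_maximal: "maximal \<mu> g \<in> borel_measurable borel"
proof (rule borel_measurableI_greater)
  fix t
  have "open {x. t < maximal \<mu> g x}"
    unfolding maximal_level_set by auto
  then show "{x \<in> space borel. t < maximal \<mu> g x} \<in> sets borel" by simp
qed

lemma le_maximal: "x \<in> ball z r \<Longrightarrow> (\<integral>\<^sup>+y\<in>ball z r. g y \<partial>\<mu>) / emeasure \<mu> (ball z r) \<le> maximal \<mu> g x"
  unfolding maximal_def by (rule SUP_upper2[of "(z, r)"]) auto

lemma sigma_finite_if_balls_finite:
  fixes M :: "'a::euclidean_space measure"
  assumes sets: "sets M = sets lebesgue" and fin: "\<And>r. emeasure M (ball 0 r) < top"
  shows "sigma_finite_measure M"
proof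
  have "\<Union> (range (\<lambda>n. ball (0::'a) (real n))) = space M"
    using reals_Archimedean2 sets_eq_imp_space_eq[OF sets] by (auto simp: dist_norm)
  moreover have "emeasure M (ball 0 (real n)) \<noteq> \<infinity>" for n
    using fin[of "real n"] by simp
  ultimately show "\<exists>A. countable A \<and> A \<subseteq> sets M \<and> \<Union> A = space M \<and> (\<forall>a\<in>A. emeasure M a \<noteq> \<infinity>)"
    by (intro exI[of _ "range (\<lambda>n. ball (0::'a) (real n))"]) (auto simp: sets)
qed

locale doubling_measure =
  fixes \<mu> :: "'a::euclidean_space measure" and D :: real
  assumes sets_eq [measurable_cong, simp]: "sets \<mu> = sets lebesgue"
    and ball_finite: "emeasure \<mu> (ball x r) < top"
    and ball_pos: "0 < r \<Longrightarrow> 0 < emeasure \<mu> (ball x r)"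
    and D_nonneg: "0 \<le> D"
    and doubling: "0 < r \<Longrightarrow> emeasure \<mu> (ball x (5 * r)) \<le> ennreal D * emeasure \<mu> (ball x r)"
begin

lemma space_eq [simp]: "space \<mu> = UNIV"
  using sets_eq_imp_space_eq[OF sets_eq] by simp

lemma open_sets [measurable]: "open S \<Longrightarrow> S \<in> sets \<mu>"
  by simp

lemma sigma_finite: "sigma_finite_measure \<mu>"
  by (rule sigma_finite_if_balls_finite) (auto simp: ball_finite)

lemma borel_measurable_mu:
  assumes "h \<in> borel_measurable borel" shows "h \<in> borel_measurable \<mu>"
proof -
  have "h \<in> borel_measurable lebesgue"
    using assms by (intro measurable_completion) simp
  then show ?thesis
    by (subst measurable_cong_sets[OF sets_eq refl])
qed

lemma measurable_maximal_mu [measurable]: "maximal \<nu> g \<in> borel_measurable \<mu>"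
  by (intro borel_measurable_mu measurable_maximal)

lemma average_less_imp_mult_le:
  assumes "t < (\<integral>\<^sup>+y\<in>ball z r. g y \<partial>\<mu>) / emeasure \<mu> (ball z r)" "0 < r"
  shows "t * emeasure \<mu> (ball z r) \<le> (\<integral>\<^sup>+y\<in>ball z r. g y \<partial>\<mu>)"
proof -
  have "t * emeasure \<mu> (ball z r) \<le> (\<integral>\<^sup>+y\<in>ball z r. g y \<partial>\<mu>) / emeasure \<mu> (ball z r) * emeasure \<mu> (ball z r)"
    using assms by (intro mult_right_mono) auto
  also have "\<dots> = (\<integral>\<^sup>+y\<in>ball z r. g y \<partial>\<mu>)"
    using ball_pos[of r z] ball_finite[of z r] assms by (simp add: ennreal_divide_times)
  finally show ?thesis .
qed

text \<open>Vitali's covering lemma picks disjoint balls whose fivefold dilates cover the level set; it needs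
  bounded radii, and this is the only reason for the truncation at \<open>R\<close>.\<close>

lemma weak_type_bounded:
  assumes [measurable]: "g \<in> borel_measurable \<mu>"
  shows "t * emeasure \<mu> (\<Union>(z, r)\<in>{(z, r). r \<le> R \<and> t < (\<integral>\<^sup>+y\<in>ball z r. g y \<partial>\<mu>) / emeasure \<mu> (ball z r)}. ball z r)
    \<le> ennreal D * (\<integral>\<^sup>+x. g x \<partial>\<mu>)" (is "t * emeasure \<mu> ?U \<le> _")
proof -
  define K where "K = {k. 0 < snd k \<and> snd k \<le> R \<and>
    t < (\<integral>\<^sup>+y\<in>ball (fst k) (snd k). g y \<partial>\<mu>) / emeasure \<mu> (ball (fst k) (snd k))}"
  have sub: "?U \<subseteq> (\<Union>k\<in>K. ball (fst k) (snd k))"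
  proof
    fix x assume "x \<in> ?U"
    then obtain z r where "x \<in> ball z r" "r \<le> R" "t < (\<integral>\<^sup>+y\<in>ball z r. g y \<partial>\<mu>) / emeasure \<mu> (ball z r)"
      by blast
    moreover from this have "0 < r" using zero_le_dist[of z x] by (simp del: zero_le_dist)
    ultimately have "(z, r) \<in> K" by (simp add: K_def)
    with \<open>x \<in> ball z r\<close> show "x \<in> (\<Union>k\<in>K. ball (fst k) (snd k))" by force
  qed
  obtain C where C: "countable C" "C \<subseteq> K"
      "pairwise (\<lambda>i j. disjnt (ball (fst i) (snd i)) (ball (fst j) (snd j))) C"
      "?U \<subseteq> (\<Union>i\<in>C. ball (fst i) (5 * snd i))"
    by (rule Vitali_covering_lemma_balls[OF sub, of R]) (auto simp: K_def)
  have disj: "disjoint_family_on (\<lambda>i. ball (fst i) (snd i)) C"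
    using C(3) by (auto simp: disjoint_family_on_def pairwise_def disjnt_def)
  have [measurable]: "?U \<in> sets \<mu>" by (intro open_sets open_UN) auto
  have cover: "indicator ?U x \<le> (\<integral>\<^sup>+i. indicator (ball (fst i) (5 * snd i)) x \<partial>count_space C)" for x
  proof (cases "x \<in> ?U")
    case True
    then obtain i where i: "i \<in> C" "x \<in> ball (fst i) (5 * snd i)" using C(4) by blast
    have "1 = (\<integral>\<^sup>+j. indicator {i} j \<partial>count_space C)"
      using i by (subst nn_integral_indicator) auto
    also have "\<dots> \<le> (\<integral>\<^sup>+i. indicator (ball (fst i) (5 * snd i)) x \<partial>count_space C)"
      using i by (intro nn_integral_mono) (auto simp: indicator_def)
    finally show ?thesis using True by (simp only: indicator_simps)
  qed (subst indicator_simps(2), assumption, rule zero_le)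
  have "t * emeasure \<mu> ?U = t * (\<integral>\<^sup>+x. indicator ?U x \<partial>\<mu>)"
    by (subst nn_integral_indicator) measurable
  also have "\<dots> \<le> t * (\<integral>\<^sup>+x. (\<integral>\<^sup>+i. indicator (ball (fst i) (5 * snd i)) x \<partial>count_space C) \<partial>\<mu>)"
    by (intro mult_left_mono nn_integral_mono cover) simp
  also have "\<dots> = t * (\<integral>\<^sup>+i. emeasure \<mu> (ball (fst i) (5 * snd i)) \<partial>count_space C)"
    by (subst nn_integral_count_space_nn_integral) (auto simp: C(1))
  also have "\<dots> = (\<integral>\<^sup>+i. t * emeasure \<mu> (ball (fst i) (5 * snd i)) \<partial>count_space C)"
    by (simp add: nn_integral_cmult)
  also have "\<dots> \<le> (\<integral>\<^sup>+i. ennreal D * (\<integral>\<^sup>+y\<in>ball (fst i) (snd i). g y \<partial>\<mu>) \<partial>count_space C)"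
  proof (intro nn_integral_mono)
    fix i assume "i \<in> space (count_space C)"
    then have i: "i \<in> K" using C(2) by auto
    have "t * emeasure \<mu> (ball (fst i) (5 * snd i)) \<le> t * (ennreal D * emeasure \<mu> (ball (fst i) (snd i)))"
      using i by (intro mult_left_mono doubling) (auto simp: K_def)
    also have "\<dots> = ennreal D * (t * emeasure \<mu> (ball (fst i) (snd i)))"
      by (simp add: mult_ac)
    also have "\<dots> \<le> ennreal D * (\<integral>\<^sup>+y\<in>ball (fst i) (snd i). g y \<partial>\<mu>)"
      using i by (intro mult_left_mono average_less_imp_mult_le) (auto simp: K_def)
    finally show "t * emeasure \<mu> (ball (fst i) (5 * snd i)) \<le> \<dots>" .
  qed
  also have "\<dots> = ennreal D * (\<integral>\<^sup>+i. emeasure (density \<mu> g) (ball (fst i) (snd i)) \<partial>count_space C)"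
    by (simp add: nn_integral_cmult emeasure_density)
  also have "(\<integral>\<^sup>+i. emeasure (density \<mu> g) (ball (fst i) (snd i)) \<partial>count_space C) =
      emeasure (density \<mu> g) (\<Union>i\<in>C. ball (fst i) (snd i))"
    by (rule emeasure_UN_countable[symmetric]) (auto simp: C(1) disj)
  also have "\<dots> \<le> emeasure (density \<mu> g) (space \<mu>)"
    by (intro emeasure_mono) auto
  also have "\<dots> = (\<integral>\<^sup>+x. g x \<partial>\<mu>)"
    by (subst emeasure_density) auto
  finally show ?thesis by (simp only: mult_left_mono zero_le)
qed

lemma weak_type:
  assumes [measurable]: "g \<in> borel_measurable \<mu>"
  shows "t * emeasure \<mu> {x. t < maximal \<mu> g x} \<le> ennreal D * (\<integral>\<^sup>+x. g x \<partial>\<mu>)"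
proof -
  define U where "U n = (\<Union>(z, r)\<in>{(z, r). r \<le> real n \<and>
    t < (\<integral>\<^sup>+y\<in>ball z r. g y \<partial>\<mu>) / emeasure \<mu> (ball z r)}. ball z r)" for n :: nat
  have *: "{x. t < maximal \<mu> g x} = (\<Union>n. U n)"
  proof (intro equalityI subsetI)
    fix x assume "x \<in> {x. t < maximal \<mu> g x}"
    then obtain z r where "x \<in> ball z r" "t < (\<integral>\<^sup>+y\<in>ball z r. g y \<partial>\<mu>) / emeasure \<mu> (ball z r)"
      unfolding maximal_level_set by blast
    moreover obtain n :: nat where "r \<le> real n" using real_arch_simple by blast
    ultimately show "x \<in> (\<Union>n. U n)" unfolding U_def by blast
  qed (unfold maximal_level_set U_def, blast)
  have "t * emeasure \<mu> {x. t < maximal \<mu> g x} = (SUP n. t * emeasure \<mu> (U n))"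
  proof -
    have "U n \<in> sets \<mu>" for n unfolding U_def by (intro open_sets open_UN) auto
    then have "range U \<subseteq> sets \<mu>" by blast
    moreover have "incseq U" 
    proof (intro monoI subsetI)
      fix m n :: nat and x assume "m \<le> n" "x \<in> U m"
      moreover from this have "r \<le> real n" if "r \<le> real m" for r using that by simp
      ultimately show "x \<in> U n" unfolding U_def by blast
    qed
    ultimately show ?thesis unfolding * by (simp add: SUP_emeasure_incseq[symmetric] SUP_mult_left_ennreal)
  qed
  also have "\<dots> \<le> ennreal D * (\<integral>\<^sup>+x. g x \<partial>\<mu>)"
    unfolding U_def by (intro SUP_least weak_type_bounded) simp
  finally show ?thesis .
qed

text \<open>Values of \<open>g\<close> below \<open>t/2\<close> raise averages by at most \<open>t/2\<close>, so only the part of \<open>g\<close> above \<open>t/2\<close>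
  can push the maximal function over the level \<open>t\<close>.\<close>

lemma weak_type_truncated:
  assumes [measurable]: "g \<in> borel_measurable \<mu>" and t: "0 < t"
  shows "ennreal t * emeasure \<mu> {x. ennreal t < maximal \<mu> g x}
    \<le> ennreal (2 * D) * (\<integral>\<^sup>+x. g x * indicator {x. ennreal t < 2 * g x} x \<partial>\<mu>)"
proof -
  define h where "h x = g x * indicator {x. ennreal t < 2 * g x} x" for x
  have "{x \<in> space \<mu>. ennreal t < 2 * g x} \<in> sets \<mu>" by measurable
  then have m: "(indicator {x. ennreal t < 2 * g x} :: _ \<Rightarrow> ennreal) \<in> borel_measurable \<mu>"
    by simp
  have [measurable]: "h \<in> borel_measurable \<mu>" unfolding h_def using m by measurable
  \<comment> \<open>The part of \<open>g\<close> that \<open>h\<close> discards is at most half the level.\<close>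
  have gh: "g x \<le> h x + ennreal (t / 2)" for x
  proof (cases "g x")
    case (real c)
    show ?thesis
    proof (cases "ennreal t < 2 * g x")
      case False
      then have "2 * ennreal c \<le> ennreal t" using real by simp
      then have "ennreal (2 * c) \<le> ennreal t" using real by (simp add: ennreal_mult)
      then show ?thesis using False real t by (simp add: h_def ennreal_leI)
    qed (simp add: h_def)
  qed (simp add: h_def ennreal_mult_top)
  have "maximal \<mu> g x \<le> maximal \<mu> h x + ennreal (t / 2)" for x
    unfolding maximal_def[of \<mu> g]
  proof (intro SUP_least, clarify)
    fix z :: 'a and r assume x: "x \<in> ball z r"
    then have r: "0 < r" using zero_le_dist[of z x] by (simp del: zero_le_dist)
    have "(\<integral>\<^sup>+y\<in>ball z r. g y \<partial>\<mu>) \<le> (\<integral>\<^sup>+y. h y * indicator (ball z r) y + ennreal (t / 2) * indicator (ball z r) y \<partial>\<mu>)"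
      using gh by (intro nn_integral_mono) (auto simp: indicator_def)
    also have "\<dots> = (\<integral>\<^sup>+y\<in>ball z r. h y \<partial>\<mu>) + ennreal (t / 2) * emeasure \<mu> (ball z r)"
      by (subst nn_integral_add) (auto simp: nn_integral_cmult_indicator)
    finally have "(\<integral>\<^sup>+y\<in>ball z r. g y \<partial>\<mu>) / emeasure \<mu> (ball z r) \<le>
       (\<integral>\<^sup>+y\<in>ball z r. h y \<partial>\<mu>) / emeasure \<mu> (ball z r) + ennreal (t / 2) * emeasure \<mu> (ball z r) / emeasure \<mu> (ball z r)"
      by (metis divide_right_mono_ennreal add_divide_distrib_ennreal)
    also have "ennreal (t / 2) * emeasure \<mu> (ball z r) / emeasure \<mu> (ball z r) = ennreal (t / 2)"
      using ball_pos[OF r, of z] ball_finite[of z r] by (intro ennreal_mult_divide_eq) auto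
    finally show "(\<integral>\<^sup>+y\<in>ball z r. g y \<partial>\<mu>) / emeasure \<mu> (ball z r) \<le> maximal \<mu> h x + ennreal (t / 2)"
      using le_maximal[OF x, of \<mu> h] by (meson add_right_mono order_trans)
  qed
  note Mgh = this
  have "{x. ennreal t < maximal \<mu> g x} \<subseteq> {x. ennreal (t / 2) < maximal \<mu> h x}"
  proof clarify
    fix x assume "ennreal t < maximal \<mu> g x"
    then have "ennreal (t / 2) + ennreal (t / 2) < maximal \<mu> h x + ennreal (t / 2)"
      using t Mgh[of x] by (subst ennreal_plus[symmetric]) auto
    then show "ennreal (t / 2) < maximal \<mu> h x" by (metis add_right_mono not_le)
  qed
  then have "ennreal t * emeasure \<mu> {x. ennreal t < maximal \<mu> g x} \<le> ennreal t * emeasure \<mu> {x. ennreal (t / 2) < maximal \<mu> h x}"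
    unfolding maximal_level_set[of _ _ h] by (intro mult_left_mono emeasure_mono open_sets open_UN) auto
  also have "\<dots> = 2 * (ennreal (t / 2) * emeasure \<mu> {x. ennreal (t / 2) < maximal \<mu> h x})"
    using t ennreal_mult[of 2 "t / 2"] by (simp add: mult.assoc[symmetric])
  also have "\<dots> \<le> 2 * (ennreal D * (\<integral>\<^sup>+x. h x \<partial>\<mu>))"
    by (intro mult_left_mono weak_type) auto
  also have "\<dots> = ennreal (2 * D) * (\<integral>\<^sup>+x. h x \<partial>\<mu>)"
    using D_nonneg by (simp add: ennreal_mult mult.assoc)
  finally show ?thesis by (simp add: h_def)
qed

text \<open>Marcinkiewicz interpolation between the weak type bound and the trivial bound for bounded functions:
  the truncated weak type estimate is inserted into the layer cake formula, and the resulting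
  integral over levels is again a layer cake, with exponent \<open>p - 1\<close>.\<close>

theorem strong_type:
  assumes [measurable]: "g \<in> borel_measurable \<mu>" and p: "1 < p"
  shows "(\<integral>\<^sup>+x. epowr (maximal \<mu> g x) p \<partial>\<mu>) \<le> ennreal (D * p * 2 powr p / (p - 1)) * (\<integral>\<^sup>+x. epowr (g x) p \<partial>\<mu>)"
proof -
  let ?I = "\<lambda>t. (\<integral>\<^sup>+x. g x * indicator {x. ennreal t < 2 * g x} x \<partial>\<mu>)"
  define c where "c = 2 * D * p / (p - 1)"
  have c: "0 \<le> c" using p D_nonneg by (simp add: c_def)
  have "(\<integral>\<^sup>+x. epowr (maximal \<mu> g x) p \<partial>\<mu>) = (\<integral>\<^sup>+x. 1 * epowr (maximal \<mu> g x) p \<partial>\<mu>)" by simp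
  also have "\<dots> = (\<integral>\<^sup>+t. ennreal (p * t powr (p - 1)) * indicator {0<..} t *
      (\<integral>\<^sup>+x. 1 * indicator {x. ennreal t < maximal \<mu> g x} x \<partial>\<mu>) \<partial>lborel)"
    using p by (intro nn_integral_mult_epowr sigma_finite) auto
  also have "\<dots> \<le> (\<integral>\<^sup>+t. ennreal c * (ennreal ((p - 1) * t powr (p - 1 - 1)) * indicator {0<..} t * ?I t) \<partial>lborel)"
  proof (intro nn_integral_mono)
    fix t :: real
    show "ennreal (p * t powr (p - 1)) * indicator {0<..} t * (\<integral>\<^sup>+x. 1 * indicator {x. ennreal t < maximal \<mu> g x} x \<partial>\<mu>)
      \<le> ennreal c * (ennreal ((p - 1) * t powr (p - 1 - 1)) * indicator {0<..} t * ?I t)"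
    proof (cases "0 < t")
      case True
      have [measurable]: "{x. ennreal t < maximal \<mu> g x} \<in> sets \<mu>"
        unfolding maximal_level_set by (intro open_sets open_UN) auto
      have "p * t powr (p - 1) = p * t powr (p - 1 - 1) * t"
        using True by (simp add: powr_diff power2_eq_square)
      then have "ennreal (p * t powr (p - 1)) * emeasure \<mu> {x. ennreal t < maximal \<mu> g x}
         = ennreal (p * t powr (p - 1 - 1)) * (ennreal t * emeasure \<mu> {x. ennreal t < maximal \<mu> g x})"
        using True p by (simp add: ennreal_mult mult.assoc)
      also have "\<dots> \<le> ennreal (p * t powr (p - 1 - 1)) * (ennreal (2 * D) * ?I t)"
        using True by (intro mult_left_mono weak_type_truncated) auto
      also have "\<dots> = ennreal (p * t powr (p - 1 - 1) * (2 * D)) * ?I t"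
        using p D_nonneg by (subst ennreal_mult) (auto simp: mult_ac)
      also have "p * t powr (p - 1 - 1) * (2 * D) = c * ((p - 1) * t powr (p - 1 - 1))"
        using p by (simp add: c_def field_simps)
      also have "ennreal \<dots> = ennreal c * ennreal ((p - 1) * t powr (p - 1 - 1))"
        using p c by (intro ennreal_mult) auto
      finally show ?thesis using True by (simp add: mult_ac del: sets_eq)
    qed simp
  qed
  also have "\<dots> = ennreal c * (\<integral>\<^sup>+t. ennreal ((p - 1) * t powr (p - 1 - 1)) * indicator {0<..} t * ?I t \<partial>lborel)"
  proof (rule nn_integral_cmult)
    have [measurable]: "?I \<in> borel_measurable borel"
      by (intro measurable_tail_integral sigma_finite) auto
    show "(\<lambda>t. ennreal ((p - 1) * t powr (p - 1 - 1)) * indicator {0<..} t * ?I t) \<in> borel_measurable lborel"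
      by measurable
  qed
  also have "(\<integral>\<^sup>+t. ennreal ((p - 1) * t powr (p - 1 - 1)) * indicator {0<..} t * ?I t \<partial>lborel)
     = (\<integral>\<^sup>+x. g x * epowr (2 * g x) (p - 1) \<partial>\<mu>)"
    using p by (intro nn_integral_mult_epowr[symmetric] sigma_finite) auto
  also have "\<dots> = (\<integral>\<^sup>+x. ennreal (2 powr (p - 1)) * epowr (g x) p \<partial>\<mu>)"
  proof (intro nn_integral_cong)
    fix x
    have "g x * epowr (2 * g x) (p - 1) = ennreal (2 powr (p - 1)) * (g x * epowr (g x) (p - 1))"
      using epowr_ennreal[of 2 "p - 1"] by (simp add: epowr_mult mult_ac)
    also have "g x * epowr (g x) (p - 1) = epowr (g x) p"
      using epowr_add[of "g x" 1 "p - 1"] by simp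
    finally show "g x * epowr (2 * g x) (p - 1) = ennreal (2 powr (p - 1)) * epowr (g x) p" .
  qed
  also have "\<dots> = ennreal (2 powr (p - 1)) * (\<integral>\<^sup>+x. epowr (g x) p \<partial>\<mu>)"
    by (rule nn_integral_cmult) auto
  also have "ennreal c * (ennreal (2 powr (p - 1)) * (\<integral>\<^sup>+x. epowr (g x) p \<partial>\<mu>)) =
      ennreal (c * 2 powr (p - 1)) * (\<integral>\<^sup>+x. epowr (g x) p \<partial>\<mu>)"
    using c by (simp add: ennreal_mult mult.assoc)
  also have "c * 2 powr (p - 1) = D * p * 2 powr p / (p - 1)"
    using p by (simp add: c_def powr_diff divide_simps)
  finally show ?thesis .
qed

end

section \<open>Muckenhoupt weights\<close>

definition weighted :: "('a::euclidean_space \<Rightarrow> real) \<Rightarrow> 'a measure" where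
  "weighted w = density lebesgue (\<lambda>x. ennreal (w x))"

lemma sets_weighted [measurable_cong, simp]: "sets (weighted w) = sets lebesgue"
  by (simp add: weighted_def)

lemma space_weighted [simp]: "space (weighted w) = UNIV"
  by (simp add: weighted_def)

lemma emeasure_weighted:
  "w \<in> borel_measurable lebesgue \<Longrightarrow> E \<in> sets lebesgue \<Longrightarrow>
    emeasure (weighted w) E = (\<integral>\<^sup>+x\<in>E. ennreal (w x) \<partial>lebesgue)"
  unfolding weighted_def by (subst emeasure_density) auto

lemma nn_integral_weighted:
  assumes "w \<in> borel_measurable lebesgue" "g \<in> borel_measurable lebesgue"
  shows "(\<integral>\<^sup>+x. g x \<partial>weighted w) = (\<integral>\<^sup>+x. g x * ennreal (w x) \<partial>lebesgue)"
  unfolding weighted_def using assms by (subst nn_integral_density) (auto simp: mult.commute)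

lemma emeasure_weighted_pos:
  assumes [measurable]: "w \<in> borel_measurable lebesgue" "E \<in> sets lebesgue" and "\<And>x. 0 < w x" "0 < emeasure lebesgue E"
  shows "0 < emeasure (weighted w) E"
proof (rule ccontr)
  assume "\<not> 0 < emeasure (weighted w) E"
  then have "(\<integral>\<^sup>+x. ennreal (w x) * indicator E x \<partial>lebesgue) = 0"
    by (simp add: emeasure_weighted)
  then have "AE x in lebesgue. ennreal (w x) * indicator E x = 0"
    by (subst (asm) nn_integral_0_iff_AE) auto
  then have "AE x in lebesgue. x \<notin> E"
    by eventually_elim (use assms(3) in \<open>auto simp: indicator_def ennreal_eq_0_iff simp flip: not_less split: if_splits\<close>)
  then have "emeasure lebesgue E = 0"
    by (subst (asm) AE_iff_measurable[of E]) auto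
  with assms show False by simp
qed

lemma measure_ball_pos: "0 < r \<Longrightarrow> 0 < measure lebesgue (ball (x::'a::euclidean_space) r)"
  using content_ball_pos[of r x] by simp

lemma measure_ball_scale:
  "0 \<le> r \<Longrightarrow> 0 \<le> k \<Longrightarrow> measure lebesgue (ball (x::'a::euclidean_space) (k * r)) = k ^ DIM('a) * measure lebesgue (ball x r)"
  using content_ball_conv_unit_ball[of "k * r" x] content_ball_conv_unit_ball[of r x]
  by (simp add: power_mult_distrib)

lemma emeasure_ball_eq: "emeasure lebesgue (ball (x::'a::euclidean_space) r) = ennreal (measure lebesgue (ball x r))"
  by (rule emeasure_eq_ennreal_measure) (use emeasure_lborel_ball_finite[of x r] in auto)

definition doubling_const :: "nat \<Rightarrow> real \<Rightarrow> real \<Rightarrow> real" where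
  "doubling_const n e K = (K * (5 ^ n) powr (1 + e)) powr (1 / e)"

definition reverse_doubling_const :: "real \<Rightarrow> real \<Rightarrow> real" where
  "reverse_doubling_const e K = 1 - 1 / (K / (1/2) powr (1 + e)) powr (1 / e)"

text \<open>
  The Muckenhoupt condition for \<open>w\<close>, written with its dual weight \<open>\<sigma> = w\<^sup>-\<^sup>e\<close> and over balls. It is the
  class \<open>A\<^sub>r\<close> with \<open>r = 1 + 1/e\<close>. For \<open>w = v\<^sup>q\<close> and \<open>e = p'/q\<close> the dual weight is \<open>v\<close> to the power
  \<open>-p'\<close>, so that the two-exponent condition of fractional integration is of this form as well.
\<close>

locale Ap_weight =
  fixes w :: "'a::euclidean_space \<Rightarrow> real" and e K :: real
  assumes w_meas [measurable]: "w \<in> borel_measurable lebesgue"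
    and w_pos: "0 < w x"
    and e_pos: "0 < e"
    and K_pos: "0 < K"
    and Ap: "0 < r \<Longrightarrow> epowr (emeasure (weighted w) (ball x r)) e * emeasure (weighted (\<lambda>x. w x powr - e)) (ball x r)
      \<le> ennreal (K * measure lebesgue (ball x r) powr (1 + e))"
begin

abbreviation W where "W \<equiv> weighted w"
abbreviation S where "S \<equiv> weighted (\<lambda>x. w x powr - e)"

lemma W_ball_pos: "0 < r \<Longrightarrow> 0 < emeasure W (ball x r)"
  using measure_ball_pos[of r x] w_pos by (intro emeasure_weighted_pos) (auto simp: emeasure_ball_eq)

lemma S_ball_pos: "0 < r \<Longrightarrow> 0 < emeasure S (ball x r)"
  using measure_ball_pos[of r x] w_pos by (intro emeasure_weighted_pos) (auto simp: emeasure_ball_eq less_imp_neq[THEN not_sym])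

lemma W_ball_finite: "emeasure W (ball x r) < top"
proof (cases "0 < r")
  case True
  then have "epowr (emeasure W (ball x r)) e * emeasure S (ball x r) < top"
    using le_less_trans[OF Ap[of r x] ennreal_less_top] by simp
  then show ?thesis using S_ball_pos[OF True, of x] by (auto simp: ennreal_mult_less_top)
qed (simp add: ball_empty)

lemma S_ball_finite: "emeasure S (ball x r) < top"
proof (cases "0 < r")
  case True
  then have "epowr (emeasure W (ball x r)) e * emeasure S (ball x r) < top"
    using le_less_trans[OF Ap[of r x] ennreal_less_top] by simp
  then show ?thesis using W_ball_pos[OF True, of x] by (auto simp: ennreal_mult_less_top)
qed (simp add: ball_empty)

text \<open>The condition is symmetric in the two weights, so everything shown for \<open>W\<close> holds for \<open>S\<close>.\<close>

lemma dual: "Ap_weight (\<lambda>x. w x powr - e) (1 / e) (K powr (1 / e))"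
proof
  fix r :: real and x :: 'a assume r: "0 < r"
  have "(\<lambda>x. (w x powr - e) powr - (1 / e)) = w"
    using e_pos w_pos by (auto simp: powr_powr less_imp_le)
  then have "epowr (emeasure S (ball x r)) (1 / e) * emeasure (weighted (\<lambda>x. (w x powr - e) powr - (1 / e))) (ball x r) =
      epowr (epowr (emeasure W (ball x r)) e * emeasure S (ball x r)) (1 / e)"
    using e_pos by (simp add: epowr_mult epowr_epowr mult.commute)
  also have "\<dots> \<le> epowr (ennreal (K * measure lebesgue (ball x r) powr (1 + e))) (1 / e)"
    using r e_pos by (intro epowr_mono Ap) auto
  also have "\<dots> = ennreal (K powr (1 / e) * measure lebesgue (ball x r) powr (1 + 1 / e))"
    using K_pos e_pos by (simp add: epowr_ennreal powr_mult powr_powr field_simps)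
  finally show "epowr (emeasure S (ball x r)) (1 / e) * emeasure (weighted (\<lambda>x. (w x powr - e) powr - (1 / e))) (ball x r) \<le> \<dots>" .
qed (use w_pos e_pos K_pos in \<open>auto simp: less_imp_neq[THEN not_sym]\<close>)

text \<open>Hoelder's inequality always gives the reverse of the Muckenhoupt condition, on every set. Both together
  compare the weight of a ball with that of its large subsets.\<close>

lemma lebesgue_le_weights:
  assumes [measurable]: "E \<in> sets lebesgue"
  shows "epowr (emeasure lebesgue E) (1 + e) \<le> epowr (emeasure W E) e * emeasure S E"
proof -
  \<comment> \<open>With this exponent the powers of \<open>w\<close> in Hoelder's inequality cancel, since \<open>a = e (1 - a)\<close>.\<close>
  define a where "a = e / (1 + e)"
  have a: "0 < a" "a < 1" and a': "1 - a = 1 / (1 + e)"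
    using e_pos by (auto simp: a_def field_simps)
  have "emeasure lebesgue E = (\<integral>\<^sup>+x. epowr (ennreal (w x) * indicator E x) a * epowr (ennreal (w x powr - e) * indicator E x) (1 - a) \<partial>lebesgue)"
  proof (subst nn_integral_indicator[symmetric], simp, intro nn_integral_cong)
    fix x
    have "w x powr a * (w x powr - e) powr (1 - a) = 1"
      using e_pos w_pos[of x] unfolding powr_powr a' by (simp add: a_def field_simps flip: powr_add)
    then show "indicator E x = epowr (ennreal (w x) * indicator E x) a * epowr (ennreal (w x powr - e) * indicator E x) (1 - a)"
      using w_pos[of x] by (auto simp: indicator_def epowr_ennreal less_imp_le simp flip: ennreal_mult)
  qed
  also have "\<dots> \<le> epowr (emeasure W E) a * epowr (emeasure S E) (1 - a)"
    using a by (subst (1 2) emeasure_weighted; (intro nn_integral_Hoelder)?) auto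
  finally have "epowr (emeasure lebesgue E) (1 + e) \<le> epowr (epowr (emeasure W E) a * epowr (emeasure S E) (1 - a)) (1 + e)"
    using e_pos by (intro epowr_mono) auto
  also have "\<dots> = epowr (emeasure W E) e * emeasure S E"
    unfolding epowr_mult epowr_epowr a' using e_pos by (simp add: a_def)
  finally show ?thesis .
qed

text \<open>A subset that is large for Lebesgue measure is large for the weight. This yields doubling (the subset
  is a smaller ball) and reverse doubling (the subset is an annulus).\<close>

lemma W_ball_le:
  assumes [measurable]: "E \<in> sets lebesgue" and E: "E \<subseteq> ball x r" and r: "0 < r"
    and \<theta>: "0 < \<theta>" "\<theta> * measure lebesgue (ball x r) \<le> measure lebesgue E"
  shows "emeasure W (ball x r) \<le> ennreal ((K / \<theta> powr (1 + e)) powr (1 / e)) * emeasure W E"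
proof -
  let ?B = "ball x r"
  define b where "b = measure lebesgue ?B"
  have b: "0 < b" using measure_ball_pos[OF r] by (simp add: b_def)
  have finE: "emeasure W E \<le> emeasure W ?B" "emeasure S E \<le> emeasure S ?B"
    using E by (auto intro!: emeasure_mono)
  obtain W0 where W0: "emeasure W ?B = ennreal W0" "0 \<le> W0" "W0 \<noteq> 0"
    using W_ball_finite[of x r] W_ball_pos[OF r, of x] by (cases "emeasure W ?B") auto
  obtain W1 where W1: "emeasure W E = ennreal W1" "0 \<le> W1"
    using finE W0 by (cases "emeasure W E") (auto simp: top_unique)
  obtain S1 where S1: "emeasure S E = ennreal S1" "0 \<le> S1"
    using finE S_ball_finite[of x r] by (cases "emeasure S E") (auto simp: top_unique)
  obtain S0 where S0: "emeasure S ?B = ennreal S0" "0 \<le> S0"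
    using S_ball_finite[of x r] by (cases "emeasure S ?B") auto
  have S10: "S1 \<le> S0" using finE S0 S1 by simp
  have "emeasure lebesgue E = ennreal (measure lebesgue E)"
    using E emeasure_lborel_ball_finite[of x r] by (intro emeasure_eq_ennreal_measure)
      (metis assms(1) emeasure_lborel_ball_finite emeasure_mono infinity_ennreal_def linorder_not_less lmeasurable_ball fmeasurableD emeasure_ball_eq ennreal_less_top top.not_eq_extremum)
  then have 1: "measure lebesgue E powr (1 + e) \<le> W1 powr e * S1"
    using lebesgue_le_weights[OF assms(1)] W1 S1 by (simp add: epowr_ennreal flip: ennreal_mult)
  have 2: "W0 powr e * S0 \<le> K * b powr (1 + e)"
    using Ap[OF r, of x] W0 S0 K_pos b by (simp add: epowr_ennreal b_def flip: ennreal_mult)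
  have "(\<theta> * b) powr (1 + e) * W0 powr e \<le> measure lebesgue E powr (1 + e) * W0 powr e"
    using \<theta> b e_pos by (intro mult_right_mono powr_mono2) (auto simp: b_def)
  also have "\<dots> \<le> (W1 powr e * S0) * W0 powr e"
    using 1 S10 by (intro mult_right_mono order_trans[OF 1] mult_left_mono) auto
  also have "\<dots> \<le> W1 powr e * (K * b powr (1 + e))"
    using mult_left_mono[OF 2, of "W1 powr e"] by (simp add: mult_ac)
  finally have "W0 powr e \<le> K / \<theta> powr (1 + e) * W1 powr e"
    using \<theta>(1) b by (simp add: powr_mult field_simps)
  then have "(W0 powr e) powr (1 / e) \<le> (K / \<theta> powr (1 + e) * W1 powr e) powr (1 / e)"
    using e_pos by (intro powr_mono2) auto
  then have "W0 \<le> (K / \<theta> powr (1 + e)) powr (1 / e) * W1"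
    using e_pos W0 W1 K_pos by (simp add: powr_powr powr_mult powr_divide)
  then show ?thesis
    using W0 W1 by (simp flip: ennreal_mult)
qed

lemma doubling_W: "doubling_measure W (doubling_const DIM('a) e K)"
proof
  fix x :: 'a and r :: real assume r: "0 < r"
  have "emeasure W (ball x (5 * r)) \<le> ennreal ((K / ((1 / 5 ^ DIM('a)) powr (1 + e))) powr (1 / e)) * emeasure W (ball x r)"
    using r measure_ball_scale[of r 5 x] by (intro W_ball_le) auto
  then show "emeasure W (ball x (5 * r)) \<le> ennreal (doubling_const DIM('a) e K) * emeasure W (ball x r)"
    by (simp add: doubling_const_def powr_divide)
qed (auto simp: W_ball_finite W_ball_pos doubling_const_def)

lemma reverse_doubling:
  assumes r: "0 < r"
  shows "measure W (ball x r) \<le> reverse_doubling_const e K * measure W (ball x (2 * r))"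
proof -
  let ?E = "ball x (2 * r) - ball x r"
  define c where "c = (K / (1/2) powr (1 + e)) powr (1 / e)"
  have c: "0 < c" using K_pos by (simp add: c_def)
  have sub: "ball x r \<subseteq> ball x (2 * r)" using r by (intro subset_ball) simp
  have le: "2 * measure lebesgue (ball x r) \<le> measure lebesgue (ball x (2 * r))"
    using r measure_ball_scale[of r 2 x] self_le_power[of "2::real" "DIM('a)"]
    by (simp add: mult_right_mono)
  have "measure lebesgue ?E = measure lebesgue (ball x (2 * r)) - measure lebesgue (ball x r)"
    using sub by (intro measurable_measure_Diff) auto
  then have "emeasure W (ball x (2 * r)) \<le> ennreal c * emeasure W ?E"
    unfolding c_def using r le by (intro W_ball_le) auto
  moreover have "emeasure W (ball x (2 * r)) \<noteq> top" "emeasure W (ball x r) \<noteq> top"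
    using W_ball_finite[of x "2 * r"] W_ball_finite[of x r] by auto
  moreover from this have "emeasure W ?E \<noteq> top"
    by (metis Diff_subset emeasure_mono neq_top_trans sets_weighted lmeasurable_ball fmeasurableD)
  ultimately have "measure W (ball x (2 * r)) \<le> c * measure W ?E"
    using c by (simp add: emeasure_eq_ennreal_measure flip: ennreal_mult)
  also have "measure W ?E = measure W (ball x (2 * r)) - measure W (ball x r)"
    using sub W_ball_finite[of x "2 * r"] by (intro measure_Diff) auto
  finally show ?thesis
    using c unfolding reverse_doubling_const_def c_def[symmetric] by (simp add: field_simps)
qed

lemma reverse_doubling_const_bounds: "0 < reverse_doubling_const e K" "reverse_doubling_const e K < 1"
proof -
  show "reverse_doubling_const e K < 1" using K_pos by (simp add: reverse_doubling_const_def)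
  have "0 < measure W (ball 0 1)" "0 < measure W (ball 0 (2 * 1))"
    using W_ball_pos W_ball_finite by (auto simp: measure_def enn2real_positive_iff)
  then show "0 < reverse_doubling_const e K"
    using reverse_doubling[of 1 0] by (smt (verit) mult_nonneg_nonneg mult_le_0_iff)
qed

end

lemma sets_lebesgue_ball [measurable]: "ball x r \<in> sets lebesgue"
  by simp

section \<open>Dyadic decomposition of the Riesz kernel\<close>

lemma le_iterated_doubling:
  fixes u :: "real \<Rightarrow> real"
  assumes "\<And>\<rho>. 0 < \<rho> \<Longrightarrow> u \<rho> \<le> \<eta> * u (2 * \<rho>)" "0 < \<eta>" "0 < \<rho>"
  shows "u \<rho> \<le> \<eta> ^ k * u (2 ^ k * \<rho>)"
proof (induction k)
  case (Suc k)
  also have "\<eta> ^ k * u (2 ^ k * \<rho>) \<le> \<eta> ^ k * (\<eta> * u (2 * (2 ^ k * \<rho>)))"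
    using assms by (intro mult_left_mono assms) auto
  finally show ?case by (simp add: mult_ac)
qed simp

text \<open>Reverse doubling forces \<open>u\<close> to grow at least geometrically along dyadic radii, from arbitrarily small
  to arbitrarily large values. So it crosses every level, without any continuity.\<close>

lemma ex_dyadic_crossing:
  fixes u :: "real \<Rightarrow> real"
  assumes u: "\<And>\<rho>. 0 < \<rho> \<Longrightarrow> 0 < u \<rho>" "\<And>\<rho>. 0 < \<rho> \<Longrightarrow> u \<rho> \<le> \<eta> * u (2 * \<rho>)"
    and \<eta>: "0 < \<eta>" "\<eta> < 1" and T: "0 < T"
  shows "\<exists>\<rho>>0. u \<rho> \<le> T \<and> T \<le> u (2 * \<rho>)"
proof -
  have geo: "u \<rho> \<le> \<eta> ^ k * u (2 ^ k * \<rho>)" if "0 < \<rho>" for k \<rho>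
    using le_iterated_doubling[of u \<eta> \<rho> k] u \<eta> that by blast
  obtain j where "\<eta> ^ j < T / u 1"
    using real_arch_pow_inv[OF _ \<eta>(2), of "T / u 1"] T u(1)[of 1] by auto
  then have j: "\<eta> ^ j * u 1 < T" using u(1)[of 1] by (simp add: field_simps)
  have uj: "u (1 / 2 ^ j) \<le> T"
    using geo[of "1 / 2 ^ j" j] j by simp
  obtain i where "\<eta> ^ i < u 1 / T"
    using real_arch_pow_inv[OF _ \<eta>(2), of "u 1 / T"] T u(1)[of 1] by auto
  then have "T * \<eta> ^ i < u 1" using T by (simp add: field_simps)
  also have "u 1 \<le> \<eta> ^ i * u (2 ^ i)" using geo[of 1 i] by simp
  finally have ui: "T < u (2 ^ i)" using \<eta> by (simp add: mult.commute)
  define P where "P k \<longleftrightarrow> T < u (2 ^ k / 2 ^ j)" for k :: nat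
  have "P (i + j)" using ui by (simp add: P_def power_add)
  moreover have "\<not> P 0" using uj by (simp add: P_def)
  ultimately obtain k where "\<not> P k" "P (Suc k)"
    using ex_least_nat_less[of P "i + j"] by blast
  then show ?thesis
    by (intro exI[of _ "2 ^ k / 2 ^ j"]) (auto simp: P_def)
qed

text \<open>
  Hedberg's trick with \<open>u\<close> in the place of the radius. Of the two bounds \<open>a u\<^sup>\<alpha>\<close> and \<open>b u\<^sup>-\<^sup>\<beta>\<close>, the first is
  used on small and the second on large scales; they meet where \<open>u\<close> crosses the level \<open>T\<close>, and from
  there both decay geometrically. \<open>G\<close> is their common value at \<open>T\<close>.
\<close>

lemma Hedberg_splitting:
  fixes u :: "real \<Rightarrow> real"
  assumes u: "\<And>\<rho>. 0 < \<rho> \<Longrightarrow> 0 < u \<rho>" "\<And>\<rho>. 0 < \<rho> \<Longrightarrow> u \<rho> \<le> \<eta> * u (2 * \<rho>)"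
    and \<eta>: "0 < \<eta>" "\<eta> < 1" and pos: "0 < \<alpha>" "0 < \<beta>" "0 < a" "0 < b"
  defines "G \<equiv> a powr (\<beta> / (\<alpha> + \<beta>)) * b powr (\<alpha> / (\<alpha> + \<beta>))"
  shows "\<exists>\<rho>>0. \<forall>k. a * u (\<rho> / 2 ^ k) powr \<alpha> \<le> G * (\<eta> powr \<alpha>) ^ k \<and>
      b * u (2 ^ Suc k * \<rho>) powr - \<beta> \<le> G * (\<eta> powr \<beta>) ^ k"
proof -
  \<comment> \<open>The level at which \<open>a u\<^sup>\<alpha>\<close> and \<open>b u\<^sup>-\<^sup>\<beta>\<close> agree.\<close>
  define T where "T = (b / a) powr (1 / (\<alpha> + \<beta>))"
  have T: "0 < T" using pos by (simp add: T_def)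
  have lnT: "ln T = (ln b - ln a) / (\<alpha> + \<beta>)"
    using pos by (simp add: T_def ln_powr ln_div)
  have lnG: "ln G = (\<beta> * ln a + \<alpha> * ln b) / (\<alpha> + \<beta>)" and G: "0 < G"
    using pos by (auto simp: G_def ln_mult ln_powr add_divide_distrib)
  have aT: "a * T powr \<alpha> = G"
  proof (subst ln_inj_iff[symmetric])
    show "ln (a * T powr \<alpha>) = ln G"
      using pos T unfolding lnG by (simp add: ln_mult ln_powr lnT field_simps)
  qed (use pos T G in auto)
  have bT: "b * T powr - \<beta> = G"
  proof (subst ln_inj_iff[symmetric])
    show "ln (b * T powr - \<beta>) = ln G"
      using pos T unfolding lnG by (simp add: ln_mult ln_powr lnT field_simps)
  qed (use pos T G in auto)
  have geo: "u \<rho> \<le> \<eta> ^ k * u (2 ^ k * \<rho>)" if "0 < \<rho>" for k \<rho>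
    using le_iterated_doubling[of u \<eta> \<rho> k] u \<eta> that by blast
  obtain \<rho> where \<rho>: "0 < \<rho>" "u \<rho> \<le> T" "T \<le> u (2 * \<rho>)"
    using ex_dyadic_crossing[of u \<eta> T] u \<eta> T by blast
  have "a * u (\<rho> / 2 ^ k) powr \<alpha> \<le> G * (\<eta> powr \<alpha>) ^ k" for k
  proof -
    have "u (\<rho> / 2 ^ k) \<le> \<eta> ^ k * T"
      using geo[of "\<rho> / 2 ^ k" k] \<rho> \<eta> by (auto intro: order_trans mult_left_mono)
    then have "u (\<rho> / 2 ^ k) powr \<alpha> \<le> (\<eta> ^ k * T) powr \<alpha>"
      using u(1)[of "\<rho> / 2 ^ k"] \<rho> pos by (intro powr_mono2) auto
    also have "\<dots> = (\<eta> powr \<alpha>) ^ k * T powr \<alpha>"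
      using \<eta> T by (simp add: powr_mult powr_realpow[symmetric] powr_powr powr_power mult.commute)
    finally show ?thesis using pos(3) by (simp flip: aT add: mult_ac)
  qed
  moreover have "b * u (2 ^ Suc k * \<rho>) powr - \<beta> \<le> G * (\<eta> powr \<beta>) ^ k" for k
  proof -
    have "T \<le> \<eta> ^ k * u (2 ^ k * (2 * \<rho>))"
      using geo[of "2 * \<rho>" k] \<rho> by simp
    then have "T / \<eta> ^ k \<le> u (2 ^ Suc k * \<rho>)"
      using \<eta> by (simp add: field_simps)
    then have "u (2 ^ Suc k * \<rho>) powr - \<beta> \<le> (T / \<eta> ^ k) powr - \<beta>"
      using T \<eta> pos by (intro powr_mono2') auto
    also have "\<dots> = (\<eta> powr \<beta>) ^ k * T powr - \<beta>"
      using \<eta> T by (simp add: powr_divide powr_minus powr_realpow[symmetric] powr_powr powr_power mult.commute field_simps)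
    finally show ?thesis using pos(4) by (simp flip: bT add: mult_ac)
  qed
  ultimately show ?thesis using \<rho>(1) by blast
qed

lemma powr_minus_cancel: "0 < t \<Longrightarrow> t powr - s * t powr s = 1" for s t :: real
  by (simp add: powr_minus)

lemma half_powr_minus: "(t / 2) powr - s = 2 powr s * t powr - s" for s t :: real
  by (simp add: powr_divide powr_minus field_simps)

lemma ennreal_term_le_suminf: "f k \<le> (\<Sum>k. f k :: ennreal)"
  using sum_le_suminf[OF summableI, of "{k}" f] by simp

text \<open>Every point lies in a single dyadic annulus, on which the kernel is comparable to its value at the outer
  radius; indicators of balls are used instead of annuli since averages over balls are estimated later.\<close>

lemma kernel_far_le:
  fixes z y :: "'a::euclidean_space"
  assumes "R \<le> norm (z - y)" "0 < R" "0 < \<gamma>"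
  shows "ennreal (norm (z - y) powr - \<gamma>) \<le>
    (\<Sum>k. ennreal (2 powr \<gamma> * (2 ^ Suc k * R) powr - \<gamma>) * indicator (ball z (2 ^ Suc k * R)) y)"
proof -
  let ?d = "norm (z - y)"
  obtain n where n: "?d / R < 2 ^ n" using real_arch_pow[of 2 "?d / R"] by auto
  define P where "P k \<longleftrightarrow> ?d < 2 ^ k * R" for k
  have "P n" "\<not> P 0" using n assms by (auto simp: P_def field_simps)
  then obtain k where k: "\<not> P k" "P (Suc k)"
    using ex_least_nat_less[of P n] by blast
  have "?d powr - \<gamma> \<le> (2 ^ k * R) powr - \<gamma>"
    using k assms by (intro powr_mono2') (auto simp: P_def)
  also have "2 ^ k * R = (2 ^ Suc k * R) / 2" by simp
  also have "\<dots> powr - \<gamma> = 2 powr \<gamma> * (2 ^ Suc k * R) powr - \<gamma>"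
    using assms by (subst powr_divide) (auto simp: powr_minus field_simps)
  finally have "ennreal (?d powr - \<gamma>) \<le> ennreal (2 powr \<gamma> * (2 ^ Suc k * R) powr - \<gamma>) * indicator (ball z (2 ^ Suc k * R)) y"
    using k by (simp add: P_def dist_norm ennreal_leI)
  also have "\<dots> \<le> (\<Sum>k. ennreal (2 powr \<gamma> * (2 ^ Suc k * R) powr - \<gamma>) * indicator (ball z (2 ^ Suc k * R)) y)"
    by (rule ennreal_term_le_suminf)
  finally show ?thesis .
qed

lemma kernel_near_le:
  fixes z y :: "'a::euclidean_space"
  assumes "norm (z - y) < R" "0 < R" "0 < \<gamma>"
  shows "ennreal (norm (z - y) powr - \<gamma>) \<le>
    (\<Sum>k. ennreal (2 powr \<gamma> * (R / 2 ^ k) powr - \<gamma>) * indicator (ball z (R / 2 ^ k)) y)"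
proof (cases "z = y")
  case False
  let ?d = "norm (z - y)"
  have d: "0 < ?d" using False by simp
  obtain n where n: "R / ?d < 2 ^ n" using real_arch_pow[of 2 "R / ?d"] by auto
  define P where "P k \<longleftrightarrow> R / 2 ^ k \<le> ?d" for k :: nat
  have "P n" "\<not> P 0" using n assms d by (auto simp: P_def field_simps)
  then obtain k where k: "\<not> P k" "P (Suc k)"
    using ex_least_nat_less[of P n] by blast
  have "?d powr - \<gamma> \<le> ((R / 2 ^ k) / 2) powr - \<gamma>"
    using k assms d by (intro powr_mono2') (auto simp: P_def field_simps)
  also have "\<dots> = 2 powr \<gamma> * (R / 2 ^ k) powr - \<gamma>"
    using assms by (subst powr_divide) (auto simp: powr_minus field_simps)
  finally have "ennreal (?d powr - \<gamma>) \<le> ennreal (2 powr \<gamma> * (R / 2 ^ k) powr - \<gamma>) * indicator (ball z (R / 2 ^ k)) y"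
    using k by (simp add: P_def dist_norm ennreal_leI)
  also have "\<dots> \<le> (\<Sum>k. ennreal (2 powr \<gamma> * (R / 2 ^ k) powr - \<gamma>) * indicator (ball z (R / 2 ^ k)) y)"
    by (rule ennreal_term_le_suminf)
  finally show ?thesis .
qed simp

lemma suminf_geometric_ennreal:
  assumes "0 \<le> c" "0 \<le> x" "x < 1"
  shows "(\<Sum>k. ennreal (c * x ^ k)) = ennreal (c / (1 - x))"
proof -
  have "(\<lambda>k. c * x ^ k) sums (c * (1 / (1 - x)))"
    using assms by (intro sums_mult geometric_sums) auto
  then show ?thesis
    using assms by (intro suminf_ennreal_eq) auto
qed

section \<open>A maximal function adapted to a weight and its dual\<close>

definition lerner_const :: "nat \<Rightarrow> real \<Rightarrow> real \<Rightarrow> real \<Rightarrow> real" where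
  "lerner_const n e K p = (doubling_const n e K * (1 + e) * 2 powr (1 + e) / e) *
     (doubling_const n (1 / e) (K powr (1 / e)) * p * 2 powr p / (p - 1))"

context Ap_weight
begin

text \<open>
  Lerner's device for Muckenhoupt's maximal theorem, adapted to fractional integrals. The average of
  \<open>f\<close> over a ball with respect to the dual weight is at most the inner maximal function at each point
  of the ball, and integrating a power of it in Lebesgue measure means averaging it, divided by \<open>w\<close>,
  with respect to \<open>W\<close>. Both maximal functions are taken with respect to doubling measures, and so
  they are bounded on every \<open>L\<^sup>r\<close> with \<open>r > 1\<close>; no self-improvement of the weight is involved.
  The exponent \<open>p/(1 + e)\<close> makes the two strong type bounds fit together.
\<close>

definition lerner_maximal :: "real \<Rightarrow> ('a \<Rightarrow> ennreal) \<Rightarrow> 'a \<Rightarrow> ennreal" where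
  "lerner_maximal p f = maximal W (\<lambda>y. epowr (maximal S (\<lambda>z. f z * ennreal (w z powr e)) y) (p / (1 + e)) * ennreal (1 / w y))"

lemma measurable_maximal_lebesgue [measurable]: "maximal \<mu> g \<in> borel_measurable lebesgue"
  by (intro measurable_completion) (simp add: measurable_maximal)

lemma measurable_lerner [measurable]: "lerner_maximal p f \<in> borel_measurable lebesgue"
  unfolding lerner_maximal_def by measurable

lemma S_ball_le:
  assumes r: "0 < r"
  shows "emeasure S (ball x r) \<le> ennreal (K * measure lebesgue (ball x r) powr (1 + e) * measure W (ball x r) powr - e)"
proof -
  obtain W0 where W0: "emeasure W (ball x r) = ennreal W0" "0 < W0"
    using W_ball_finite[of x r] W_ball_pos[OF r, of x] by (cases "emeasure W (ball x r)") auto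
  obtain S0 where S0: "emeasure S (ball x r) = ennreal S0" "0 \<le> S0"
    using S_ball_finite[of x r] by (cases "emeasure S (ball x r)") auto
  have "W0 powr e * S0 \<le> K * measure lebesgue (ball x r) powr (1 + e)"
    using Ap[OF r, of x] W0 S0 K_pos by (simp add: epowr_ennreal flip: ennreal_mult)
  then have "S0 \<le> K * measure lebesgue (ball x r) powr (1 + e) * W0 powr - e"
    using W0 by (simp add: powr_minus field_simps)
  then show ?thesis using W0 S0 by (simp add: measure_def ennreal_leI)
qed

text \<open>This is the bound on small scales: the power of the weight of the ball is positive in the application.\<close>

lemma integral_ball_le_lerner:
  assumes r: "0 < r" and p: "0 < p" and [measurable]: "f \<in> borel_measurable lebesgue"
  shows "(\<integral>\<^sup>+y\<in>ball x r. f y \<partial>lebesgue) \<le>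
    ennreal (K * measure lebesgue (ball x r) powr (1 + e - (1 + e) / p) * measure W (ball x r) powr ((1 + e) / p - e))
      * epowr (lerner_maximal p f x) ((1 + e) / p)"
proof -
  define s where "s = p / (1 + e)"
  have s: "0 < s" "1 / s = (1 + e) / p" using p e_pos by (auto simp: s_def)
  define F where "F z = f z * ennreal (w z powr e)" for z
  have [measurable]: "F \<in> borel_measurable lebesgue" unfolding F_def by measurable
  define b where "b = measure lebesgue (ball x r)"
  have b: "0 < b" "emeasure lebesgue (ball x r) = ennreal b"
    using measure_ball_pos[OF r] by (auto simp: b_def emeasure_ball_eq)
  define W0 where "W0 = measure W (ball x r)"
  have W0: "emeasure W (ball x r) = ennreal W0" "0 < W0"
    using W_ball_finite[of x r] W_ball_pos[OF r, of x]
    by (cases "emeasure W (ball x r)"; simp add: W0_def measure_def)+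
  let ?I = "\<integral>\<^sup>+y\<in>ball x r. f y \<partial>lebesgue"
  define A where "A = ?I / emeasure S (ball x r)"
  have FS: "(\<integral>\<^sup>+y\<in>ball x r. F y \<partial>S) = ?I"
  proof -
    have eq: "F y * ennreal (w y powr - e) = f y" for y
      using w_pos[of y] by (simp add: F_def mult.assoc powr_minus flip: ennreal_mult)
    have eq': "F y * indicator (ball x r) y * ennreal (w y powr - e) = f y * indicator (ball x r) y" for y
      by (cases "y \<in> ball x r") (simp_all add: indicator_def eq)
    have "(\<integral>\<^sup>+y\<in>ball x r. F y \<partial>S) = (\<integral>\<^sup>+y. F y * indicator (ball x r) y * ennreal (w y powr - e) \<partial>lebesgue)"
      by (rule nn_integral_weighted) measurable
    then show ?thesis unfolding eq' .
  qed
  have "A \<le> maximal S F y" if "y \<in> ball x r" for y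
    using le_maximal[OF that, of S F] by (simp add: A_def FS)
  then have "(\<integral>\<^sup>+y\<in>ball x r. epowr A s \<partial>lebesgue) \<le> (\<integral>\<^sup>+y\<in>ball x r. epowr (maximal S F y) s \<partial>lebesgue)"
    using s by (intro nn_integral_mono) (auto simp: indicator_def intro!: epowr_mono)
  also have "\<dots> = (\<integral>\<^sup>+y\<in>ball x r. epowr (maximal S F y) s * ennreal (1 / w y) \<partial>W)"
  proof (subst nn_integral_weighted)
    have "ennreal (1 / w y) * ennreal (w y) = 1" for y
      using w_pos[of y] by (simp flip: ennreal_mult)
    then show "(\<integral>\<^sup>+y\<in>ball x r. epowr (maximal S F y) s \<partial>lebesgue) =
      (\<integral>\<^sup>+ y. epowr (maximal S F y) s * ennreal (1 / w y) * indicator (ball x r) y * ennreal (w y) \<partial>lebesgue)"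
      by (intro nn_integral_cong) (simp add: indicator_def mult.assoc)
  qed measurable
  also have "\<dots> \<le> lerner_maximal p f x * emeasure W (ball x r)"
  proof -
    have "(\<integral>\<^sup>+y\<in>ball x r. epowr (maximal S F y) s * ennreal (1 / w y) \<partial>W) / emeasure W (ball x r) \<le> lerner_maximal p f x"
      using le_maximal[of x x r W "\<lambda>y. epowr (maximal S F y) s * ennreal (1 / w y)"] r
      by (simp add: lerner_maximal_def F_def[abs_def] s_def)
    then have "(\<integral>\<^sup>+y\<in>ball x r. epowr (maximal S F y) s * ennreal (1 / w y) \<partial>W) / emeasure W (ball x r) * emeasure W (ball x r)
       \<le> lerner_maximal p f x * emeasure W (ball x r)"
      by (rule mult_right_mono) simp
    then show ?thesis using W0 by (simp add: ennreal_divide_times)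
  qed
  finally have "epowr A s * ennreal b \<le> lerner_maximal p f x * ennreal W0"
    by (simp add: nn_integral_cmult_indicator b(2) W0)
  then have "epowr A s * ennreal b * ennreal (1 / b) \<le> lerner_maximal p f x * ennreal W0 * ennreal (1 / b)"
    by (rule mult_right_mono) simp
  then have "epowr A s \<le> lerner_maximal p f x * ennreal (W0 / b)"
    using b(1) W0(2) by (simp add: mult.assoc flip: ennreal_mult)
  then have "epowr (epowr A s) (1 / s) \<le> epowr (lerner_maximal p f x * ennreal (W0 / b)) (1 / s)"
    using s p e_pos by (intro epowr_mono) auto
  then have A_le: "A \<le> ennreal ((W0 / b) powr (1 / s)) * epowr (lerner_maximal p f x) (1 / s)"
    using s(1) b(1) W0(2) by (simp add: epowr_epowr epowr_mult epowr_ennreal mult.commute)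
  have "?I = emeasure S (ball x r) * A"
    using S_ball_pos[OF r, of x] S_ball_finite[of x r] by (simp add: A_def ennreal_times_divide mult_divide_eq_ennreal mult.commute[of "emeasure S _"])
  also have "\<dots> \<le> ennreal (K * b powr (1 + e) * W0 powr - e) * (ennreal ((W0 / b) powr (1 / s)) * epowr (lerner_maximal p f x) (1 / s))"
    using S_ball_le[OF r, of x] A_le by (intro mult_mono) (auto simp: b_def W0_def)
  also have "\<dots> = ennreal (K * b powr (1 + e) * W0 powr - e * (W0 / b) powr (1 / s)) * epowr (lerner_maximal p f x) (1 / s)"
    using K_pos by (subst ennreal_mult) (auto simp: mult.assoc)
  also have "K * b powr (1 + e) * W0 powr - e * (W0 / b) powr (1 / s) = K * b powr (1 + e - 1 / s) * W0 powr (1 / s - e)"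
    using b(1) W0(2) by (simp add: powr_divide powr_diff powr_minus field_simps)
  finally show ?thesis by (simp add: s b_def W0_def)
qed

text \<open>The outer bound has exponent \<open>1 + e\<close> and the inner one exponent \<open>p\<close>. In between, the factors \<open>w\<close> and
  \<open>1/w\<close> combine to \<open>w\<close> to the power \<open>1 - (1 + e) = -e\<close>, which is the density of the dual measure.\<close>

lemma lerner_strong_type:
  assumes p: "1 < p" and [measurable]: "f \<in> borel_measurable lebesgue"
  shows "(\<integral>\<^sup>+x. epowr (lerner_maximal p f x) (1 + e) \<partial>W) \<le>
    ennreal (lerner_const DIM('a) e K p) * (\<integral>\<^sup>+x. epowr (f x) p * ennreal (w x powr (e * (p - 1))) \<partial>lebesgue)"
proof -
  interpret dW: doubling_measure W "doubling_const DIM('a) e K" by (rule doubling_W)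
  interpret dS: doubling_measure S "doubling_const DIM('a) (1 / e) (K powr (1 / e))"
    by (rule Ap_weight.doubling_W[OF dual])
  define F where "F z = f z * ennreal (w z powr e)" for z
  have F [measurable]: "F \<in> borel_measurable lebesgue" unfolding F_def by measurable
  define G where "G y = epowr (maximal S F y) (p / (1 + e)) * ennreal (1 / w y)" for y
  have G [measurable]: "G \<in> borel_measurable lebesgue" unfolding G_def by measurable
  define c1 where "c1 = doubling_const DIM('a) e K * (1 + e) * 2 powr (1 + e) / e"
  define c2 where "c2 = doubling_const DIM('a) (1 / e) (K powr (1 / e)) * p * 2 powr p / (p - 1)"
  have c: "0 \<le> c1" "0 \<le> c2" using p e_pos by (auto simp: c1_def c2_def doubling_const_def)
  have "(\<integral>\<^sup>+x. epowr (lerner_maximal p f x) (1 + e) \<partial>W) \<le> ennreal c1 * (\<integral>\<^sup>+x. epowr (G x) (1 + e) \<partial>W)"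
    using dW.strong_type[of G "1 + e"] e_pos
    by (simp add: lerner_maximal_def c1_def G_def[abs_def] F_def[abs_def])
  also have "(\<integral>\<^sup>+x. epowr (G x) (1 + e) \<partial>W) = (\<integral>\<^sup>+x. epowr (G x) (1 + e) * ennreal (w x) \<partial>lebesgue)"
    by (rule nn_integral_weighted) measurable
  also have "\<dots> = (\<integral>\<^sup>+x. epowr (maximal S F x) p * ennreal (w x powr - e) \<partial>lebesgue)"
  proof (intro nn_integral_cong)
    fix x
    have "(1 / w x) powr (1 + e) * w x = w x powr - e"
      using w_pos[of x] by (simp add: powr_divide powr_add powr_minus field_simps)
    then have "ennreal ((1 / w x) powr (1 + e)) * ennreal (w x) = ennreal (w x powr - e)"
      using w_pos[of x] by (simp flip: ennreal_mult)
    then show "epowr (G x) (1 + e) * ennreal (w x) = epowr (maximal S F x) p * ennreal (w x powr - e)"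
      using e_pos w_pos[of x] by (simp add: G_def epowr_mult epowr_epowr epowr_ennreal less_imp_le mult.assoc)
  qed
  also have "\<dots> = (\<integral>\<^sup>+x. epowr (maximal S F x) p \<partial>S)"
    by (rule nn_integral_weighted[symmetric]) measurable
  also have "ennreal c1 * \<dots> \<le> ennreal c1 * (ennreal c2 * (\<integral>\<^sup>+x. epowr (F x) p \<partial>S))"
    unfolding c2_def using p by (intro mult_left_mono dS.strong_type) auto
  also have "(\<integral>\<^sup>+x. epowr (F x) p \<partial>S) = (\<integral>\<^sup>+x. epowr (F x) p * ennreal (w x powr - e) \<partial>lebesgue)"
    by (rule nn_integral_weighted) measurable
  also have "\<dots> = (\<integral>\<^sup>+x. epowr (f x) p * ennreal (w x powr (e * (p - 1))) \<partial>lebesgue)"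
  proof (intro nn_integral_cong)
    fix x
    have "(w x powr e) powr p * w x powr - e = w x powr (e * (p - 1))"
      using w_pos[of x] by (simp add: powr_powr algebra_simps flip: powr_add)
    then have "ennreal ((w x powr e) powr p) * ennreal (w x powr - e) = ennreal (w x powr (e * (p - 1)))"
      by (simp flip: ennreal_mult)
    then show "epowr (F x) p * ennreal (w x powr - e) = epowr (f x) p * ennreal (w x powr (e * (p - 1)))"
      by (simp add: F_def epowr_mult epowr_ennreal mult.assoc)
  qed
  finally show ?thesis
    unfolding lerner_const_def c1_def[symmetric] c2_def[symmetric] using c by (simp add: ennreal_mult mult.assoc)
qed

text \<open>This is the bound on large scales, where the weight of the ball occurs with a negative power.\<close>

lemma integral_ball_le_Hoelder:
  assumes r: "0 < r" and p: "1 < p" and [measurable]: "f \<in> borel_measurable lebesgue"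
  shows "(\<integral>\<^sup>+y\<in>ball x r. f y \<partial>lebesgue) \<le>
    ennreal (K powr (1 - 1 / p) * measure lebesgue (ball x r) powr ((1 + e) * (1 - 1 / p)) * measure W (ball x r) powr - (e * (1 - 1 / p)))
      * epowr (\<integral>\<^sup>+x. epowr (f x) p * ennreal (w x powr (e * (p - 1))) \<partial>lebesgue) (1 / p)"
proof -
  have p': "0 < 1 / p" "1 / p < 1" using p by auto
  have "(\<integral>\<^sup>+y\<in>ball x r. f y \<partial>lebesgue) =
     (\<integral>\<^sup>+y. epowr (epowr (f y) p * ennreal (w y powr (e * (p - 1)))) (1 / p) *
        epowr (ennreal (w y powr - e) * indicator (ball x r) y) (1 - 1 / p) \<partial>lebesgue)"
  proof (intro nn_integral_cong)
    fix y
    have "e * (p - 1) * (1 / p) + - e * (1 - 1 / p) = 0" using p by (simp add: field_simps)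
    then have "ennreal ((w y powr (e * (p - 1))) powr (1 / p)) * ennreal ((w y powr - e) powr (1 - 1 / p)) = 1"
      using w_pos[of y] unfolding powr_powr by (simp flip: ennreal_mult powr_add)
    then have "epowr (ennreal (w y powr (e * (p - 1)))) (1 / p) * epowr (ennreal (w y powr - e)) (1 - 1 / p) = 1"
      by (simp add: epowr_ennreal)
    then show "f y * indicator (ball x r) y = epowr (epowr (f y) p * ennreal (w y powr (e * (p - 1)))) (1 / p) *
        epowr (ennreal (w y powr - e) * indicator (ball x r) y) (1 - 1 / p)"
      using p by (auto simp: indicator_def epowr_mult epowr_epowr mult.assoc)
  qed
  also have "\<dots> \<le> epowr (\<integral>\<^sup>+x. epowr (f x) p * ennreal (w x powr (e * (p - 1))) \<partial>lebesgue) (1 / p) * epowr (emeasure S (ball x r)) (1 - 1 / p)"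
  proof (subst emeasure_weighted)
    show "(\<integral>\<^sup>+y. epowr (epowr (f y) p * ennreal (w y powr (e * (p - 1)))) (1 / p) *
        epowr (ennreal (w y powr - e) * indicator (ball x r) y) (1 - 1 / p) \<partial>lebesgue)
      \<le> epowr (\<integral>\<^sup>+x. epowr (f x) p * ennreal (w x powr (e * (p - 1))) \<partial>lebesgue) (1 / p) *
        epowr (\<integral>\<^sup>+y\<in>ball x r. ennreal (w y powr - e) \<partial>lebesgue) (1 - 1 / p)"
      using p' by (intro nn_integral_Hoelder) measurable
  qed auto
  also have "\<dots> \<le> epowr (\<integral>\<^sup>+x. epowr (f x) p * ennreal (w x powr (e * (p - 1))) \<partial>lebesgue) (1 / p) *
      epowr (ennreal (K * measure lebesgue (ball x r) powr (1 + e) * measure W (ball x r) powr - e)) (1 - 1 / p)"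
    using p' S_ball_le[OF r] by (intro mult_left_mono epowr_mono) auto
  also have "epowr (ennreal (K * measure lebesgue (ball x r) powr (1 + e) * measure W (ball x r) powr - e)) (1 - 1 / p) =
     ennreal (K powr (1 - 1 / p) * measure lebesgue (ball x r) powr ((1 + e) * (1 - 1 / p)) * measure W (ball x r) powr - (e * (1 - 1 / p)))"
    using K_pos by (simp add: epowr_ennreal powr_mult powr_powr)
  finally show ?thesis by (simp add: mult.commute)
qed

end

section \<open>The weighted inequality for fractional integrals\<close>

text \<open>The Riesz potential of a nonnegative function, with values in \<open>[0, \<infinity>]\<close>; the kernel has exponent \<open>\<gamma> = d - \<lambda>\<close>.\<close>

definition riesz_int :: "real \<Rightarrow> ('a::euclidean_space \<Rightarrow> ennreal) \<Rightarrow> 'a \<Rightarrow> ennreal" where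
  "riesz_int \<gamma> f x = (\<integral>\<^sup>+y. ennreal (norm (x - y) powr - \<gamma>) * f y \<partial>lebesgue)"

lemma nn_integral_ball_series:
  assumes [measurable]: "f \<in> borel_measurable lebesgue"
  shows "(\<integral>\<^sup>+y. (\<Sum>k::nat. ennreal (c k) * indicator (ball x (r k)) y) * f y \<partial>lebesgue) =
    (\<Sum>k. ennreal (c k) * (\<integral>\<^sup>+y\<in>ball x (r k). f y \<partial>lebesgue))"
proof -
  have "(\<integral>\<^sup>+y. (\<Sum>k. ennreal (c k) * indicator (ball x (r k)) y) * f y \<partial>lebesgue) =
      (\<integral>\<^sup>+y. (\<Sum>k. ennreal (c k) * (f y * indicator (ball x (r k)) y)) \<partial>lebesgue)"
    by (intro nn_integral_cong) (simp add: mult_ac flip: ennreal_suminf_multc)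
  also have "\<dots> = (\<Sum>k. \<integral>\<^sup>+y. ennreal (c k) * (f y * indicator (ball x (r k)) y) \<partial>lebesgue)"
    by (rule nn_integral_suminf) measurable
  also have "(\<lambda>k. \<integral>\<^sup>+y. ennreal (c k) * (f y * indicator (ball x (r k)) y) \<partial>lebesgue) =
     (\<lambda>k. ennreal (c k) * (\<integral>\<^sup>+y\<in>ball x (r k). f y \<partial>lebesgue))"
    by (intro ext nn_integral_cmult) measurable
  finally show ?thesis .
qed

lemma riesz_int_le_series:
  assumes \<rho>: "0 < \<rho>" and \<gamma>: "0 < \<gamma>" and [measurable]: "f \<in> borel_measurable lebesgue"
  shows "riesz_int \<gamma> f x \<le>
    (\<Sum>k. ennreal (2 powr \<gamma> * (\<rho> / 2 ^ k) powr - \<gamma>) * (\<integral>\<^sup>+y\<in>ball x (\<rho> / 2 ^ k). f y \<partial>lebesgue)) +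
    (\<Sum>k. ennreal (2 powr \<gamma> * (2 ^ Suc k * \<rho>) powr - \<gamma>) * (\<integral>\<^sup>+y\<in>ball x (2 ^ Suc k * \<rho>). f y \<partial>lebesgue))"
proof -
  let ?a = "\<lambda>y. \<Sum>k. ennreal (2 powr \<gamma> * (\<rho> / 2 ^ k) powr - \<gamma>) * indicator (ball x (\<rho> / 2 ^ k)) y"
  let ?b = "\<lambda>y. \<Sum>k. ennreal (2 powr \<gamma> * (2 ^ Suc k * \<rho>) powr - \<gamma>) * indicator (ball x (2 ^ Suc k * \<rho>)) y"
  have "riesz_int \<gamma> f x \<le> (\<integral>\<^sup>+y. ?a y * f y + ?b y * f y \<partial>lebesgue)"
    unfolding riesz_int_def
  proof (intro nn_integral_mono)
    fix y
    have "ennreal (norm (x - y) powr - \<gamma>) \<le> ?a y + ?b y"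
    proof (cases "norm (x - y) < \<rho>")
      case True
      then show ?thesis using kernel_near_le[OF True \<rho> \<gamma>] by (rule_tac add_increasing2) auto
    next
      case False
      then show ?thesis using kernel_far_le[of \<rho> x y \<gamma>] \<rho> \<gamma> by (intro add_increasing) auto
    qed
    then have "ennreal (norm (x - y) powr - \<gamma>) * f y \<le> (?a y + ?b y) * f y"
      by (rule mult_right_mono) simp
    then show "ennreal (norm (x - y) powr - \<gamma>) * f y \<le> ?a y * f y + ?b y * f y"
      by (simp add: distrib_right)
  qed
  also have "\<dots> = (\<integral>\<^sup>+y. ?a y * f y \<partial>lebesgue) + (\<integral>\<^sup>+y. ?b y * f y \<partial>lebesgue)"
    by (rule nn_integral_add) measurable
  finally show ?thesis unfolding nn_integral_ball_series[OF assms(3)] .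
qed

definition ball_const :: "'a::euclidean_space itself \<Rightarrow> real" where
  "ball_const _ = measure lebesgue (ball (0::'a) 1)"

definition hedberg_const :: "nat \<Rightarrow> real \<Rightarrow> real \<Rightarrow> real \<Rightarrow> real \<Rightarrow> real \<Rightarrow> real \<Rightarrow> real" where
  "hedberg_const n \<kappa> e K p q \<gamma> =
    2 powr \<gamma> * ((K * \<kappa> powr (\<gamma> / n)) powr (p / q) * (K powr (1 - 1 / p) * \<kappa> powr (\<gamma> / n)) powr (1 - p / q)) *
     (1 / (1 - reverse_doubling_const e K powr (1 / p - 1 / q)) + 1 / (1 - reverse_doubling_const e K powr (1 / q)))"

context Ap_weight
begin

text \<open>
  The weighted Hedberg inequality. The small-scale bound is \<open>N W(B)\<close> to the power \<open>1/p - 1/q\<close>, the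
  large-scale bound is \<open>A W(B)\<close> to the power \<open>-1/q\<close>, and reverse doubling of \<open>W\<close> makes both sums
  geometric. The relation between \<open>\<gamma>\<close>, \<open>p\<close> and \<open>q\<close> is what cancels all powers of the radius.
\<close>

lemma riesz_int_le_lerner:
  assumes p: "1 < p" "p < q" and e: "e * (1 - 1 / p) = 1 / q"
    and \<gamma>: "\<gamma> = DIM('a) * (1 - 1 / p + 1 / q)"
    and [measurable]: "f \<in> borel_measurable lebesgue"
    and A: "0 < A" "(\<integral>\<^sup>+x. epowr (f x) p * ennreal (w x powr (e * (p - 1))) \<partial>lebesgue) \<le> ennreal (A powr p)"
  defines "C \<equiv> hedberg_const DIM('a) (ball_const TYPE('a)) e K p q \<gamma>"
  shows "riesz_int \<gamma> f x \<le> ennreal (C * A powr (1 - p / q)) * epowr (lerner_maximal p f x) ((1 + e) / q)"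
proof -
  define \<eta> where "\<eta> = reverse_doubling_const e K"
  have \<eta>: "0 < \<eta>" "\<eta> < 1" using reverse_doubling_const_bounds by (auto simp: \<eta>_def)
  define \<alpha> where "\<alpha> = 1 / p - 1 / q"
  define \<beta> where "\<beta> = 1 / q"
  have ab: "0 < \<alpha>" "0 < \<beta>" "\<beta> / (\<alpha> + \<beta>) = p / q" "\<alpha> / (\<alpha> + \<beta>) = 1 - p / q"
    using p by (auto simp: \<alpha>_def \<beta>_def field_simps)
  have \<gamma>0: "0 < \<gamma>"
  proof -
    have "0 < 1 - 1 / p + 1 / q" using p by (intro add_pos_pos) auto
    then show ?thesis unfolding \<gamma> by simp
  qed
  have \<gamma>n: "\<gamma> / DIM('a) = 1 - 1 / p + 1 / q" by (simp add: \<gamma>)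
  have ex: "1 + e - (1 + e) / p = \<gamma> / DIM('a)" "(1 + e) * (1 - 1 / p) = \<gamma> / DIM('a)"
    "(1 + e) / p - e = \<alpha>" "e * (1 - 1 / p) = \<beta>"
    using e unfolding \<gamma>n by (simp_all add: \<alpha>_def \<beta>_def algebra_simps add_divide_distrib)
  define \<kappa> where "\<kappa> = ball_const TYPE('a)"
  have \<kappa>: "0 < \<kappa>" unfolding \<kappa>_def ball_const_def by (rule measure_ball_pos) simp
  define \<kappa>0 where "\<kappa>0 = \<kappa> powr (\<gamma> / DIM('a))"
  have \<kappa>0: "0 < \<kappa>0" using \<kappa> by (simp add: \<kappa>0_def)
  have vol: "measure lebesgue (ball x r) powr (\<gamma> / DIM('a)) = \<kappa>0 * r powr \<gamma>" if "0 < r" for r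
  proof -
    have "measure lebesgue (ball x r) = r powr DIM('a) * \<kappa>"
      using content_ball_conv_unit_ball[of r x] that by (simp add: \<kappa>_def ball_const_def powr_realpow)
    then show ?thesis using that \<kappa> by (simp add: powr_mult powr_powr \<kappa>0_def)
  qed
  define u where "u r = measure W (ball x r)" for r
  have u: "0 < u r" if "0 < r" for r
    using W_ball_finite[of x r] W_ball_pos[OF that, of x] by (cases "emeasure W (ball x r)"; simp add: u_def measure_def)
  have uu: "u r \<le> \<eta> * u (2 * r)" if "0 < r" for r
    using reverse_doubling[OF that, of x] by (simp add: u_def \<eta>_def)
  define Z where "Z = 1 / (1 - \<eta> powr \<alpha>) + 1 / (1 - \<eta> powr \<beta>)"
  have \<eta>ab: "\<eta> powr \<alpha> < 1" "\<eta> powr \<beta> < 1"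
    using \<eta> ab powr_less_mono2[of _ \<eta> 1] by simp_all
  have Z: "0 < Z" unfolding Z_def using \<eta>ab by (intro add_pos_pos) auto
  define Q where "Q = (K * \<kappa>0) powr (p / q) * (K powr (1 - 1 / p) * \<kappa>0) powr (1 - p / q)"
  have Q: "0 < Q" using K_pos \<kappa>0 by (simp add: Q_def)
  have C: "C = 2 powr \<gamma> * Q * Z"
    unfolding C_def hedberg_const_def Q_def Z_def \<kappa>0_def \<kappa>_def \<alpha>_def \<beta>_def \<eta>_def by simp
  have I1: "ennreal (2 powr \<gamma> * r powr - \<gamma>) * (\<integral>\<^sup>+y\<in>ball x r. f y \<partial>lebesgue) \<le>
     ennreal (2 powr \<gamma> * (K * \<kappa>0 * u r powr \<alpha>)) * epowr (lerner_maximal p f x) ((1 + e) / p)" if "0 < r" for r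
  proof -
    have "ennreal (2 powr \<gamma> * r powr - \<gamma>) * (\<integral>\<^sup>+y\<in>ball x r. f y \<partial>lebesgue) \<le> ennreal (2 powr \<gamma> * r powr - \<gamma>) *
       (ennreal (K * (\<kappa>0 * r powr \<gamma>) * u r powr \<alpha>) * epowr (lerner_maximal p f x) ((1 + e) / p))"
      using integral_ball_le_lerner[OF that _ assms(5), of p x] p
      unfolding ex vol[OF that] u_def by (intro mult_left_mono) auto
    also have "\<dots> = ennreal (2 powr \<gamma> * r powr - \<gamma> * (K * (\<kappa>0 * r powr \<gamma>) * u r powr \<alpha>)) * epowr (lerner_maximal p f x) ((1 + e) / p)"
      using K_pos \<kappa>0 by (subst ennreal_mult) (auto simp: mult.assoc)
    also have "2 powr \<gamma> * r powr - \<gamma> * (K * (\<kappa>0 * r powr \<gamma>) * u r powr \<alpha>) = 2 powr \<gamma> * (K * \<kappa>0 * u r powr \<alpha>)"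
      using that by (simp add: powr_minus field_simps)
    finally show ?thesis .
  qed
  have I2: "ennreal (2 powr \<gamma> * r powr - \<gamma>) * (\<integral>\<^sup>+y\<in>ball x r. f y \<partial>lebesgue) \<le>
     ennreal (2 powr \<gamma> * (K powr (1 - 1 / p) * \<kappa>0 * A * u r powr - \<beta>))" if "0 < r" for r
  proof -
    have "epowr (\<integral>\<^sup>+x. epowr (f x) p * ennreal (w x powr (e * (p - 1))) \<partial>lebesgue) (1 / p) \<le> epowr (ennreal (A powr p)) (1 / p)"
      using p A by (intro epowr_mono) auto
    also have "\<dots> = ennreal A" using p A by (simp add: epowr_ennreal powr_powr)
    finally have A': "epowr (\<integral>\<^sup>+x. epowr (f x) p * ennreal (w x powr (e * (p - 1))) \<partial>lebesgue) (1 / p) \<le> ennreal A" .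
    have "(\<integral>\<^sup>+y\<in>ball x r. f y \<partial>lebesgue) \<le> ennreal (K powr (1 - 1 / p) * (\<kappa>0 * r powr \<gamma>) * u r powr - \<beta>) *
        epowr (\<integral>\<^sup>+x. epowr (f x) p * ennreal (w x powr (e * (p - 1))) \<partial>lebesgue) (1 / p)"
      using integral_ball_le_Hoelder[OF that p(1) assms(5), of x]
      unfolding ex vol[OF that] u_def .
    also have "\<dots> \<le> ennreal (K powr (1 - 1 / p) * (\<kappa>0 * r powr \<gamma>) * u r powr - \<beta>) * ennreal A"
      by (rule mult_left_mono[OF A']) simp
    finally have "ennreal (2 powr \<gamma> * r powr - \<gamma>) * (\<integral>\<^sup>+y\<in>ball x r. f y \<partial>lebesgue) \<le> ennreal (2 powr \<gamma> * r powr - \<gamma>) *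
       (ennreal (K powr (1 - 1 / p) * (\<kappa>0 * r powr \<gamma>) * u r powr - \<beta>) * ennreal A)"
      by (rule mult_left_mono) simp
    also have "\<dots> = ennreal (2 powr \<gamma> * r powr - \<gamma> * (K powr (1 - 1 / p) * (\<kappa>0 * r powr \<gamma>) * u r powr - \<beta> * A))"
      using A(1) \<kappa>0 by (simp flip: ennreal_mult)
    also have "2 powr \<gamma> * r powr - \<gamma> * (K powr (1 - 1 / p) * (\<kappa>0 * r powr \<gamma>) * u r powr - \<beta> * A) = 
       2 powr \<gamma> * (K powr (1 - 1 / p) * \<kappa>0 * A * u r powr - \<beta>)"
      using that by (simp add: powr_minus field_simps)
    finally show ?thesis .
  qed
  \<comment> \<open>Where the maximal function is infinite nothing is claimed, and where it vanishes so do all averages of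
    \<open>f\<close>; only the remaining case has a scale at which the two bounds balance.\<close>
  consider "lerner_maximal p f x = top" | "lerner_maximal p f x = 0" | L where "lerner_maximal p f x = ennreal L" "0 < L"
    by (cases "lerner_maximal p f x") (force simp: less_le)+
  then show ?thesis
  proof cases
    case 1
    have "0 < C" using Q Z by (simp add: C)
    then show ?thesis using 1 A(1) by (simp add: ennreal_mult_top)
  next
    case 2
    have 0: "ennreal (2 powr \<gamma> * r powr - \<gamma>) * (\<integral>\<^sup>+y\<in>ball x r. f y \<partial>lebesgue) = 0" if "0 < r" for r
      using I1[OF that] 2 by simp
    have "riesz_int \<gamma> f x \<le> (\<Sum>k::nat. 0) + (\<Sum>k::nat. 0)"
      using riesz_int_le_series[OF _ \<gamma>0 assms(5), of 1 x] by (simp only: 0 zero_less_mult_iff zero_less_divide_iff zero_less_power zero_less_one zero_less_numeral simp_thms)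
    then show ?thesis by simp
  next
    case (3 L)
    define N where "N = L powr ((1 + e) / p)"
    have N: "0 < N" "epowr (lerner_maximal p f x) ((1 + e) / p) = ennreal N"
      using 3 by (auto simp: N_def epowr_ennreal)
    define a where "a = K * \<kappa>0 * N"
    define b where "b = K powr (1 - 1 / p) * \<kappa>0 * A"
    have ab0: "0 < a" "0 < b" using K_pos \<kappa>0 N A by (auto simp: a_def b_def)
    define G where "G = a powr (p / q) * b powr (1 - p / q)"
    have G0: "0 < G" using ab0 by (simp add: G_def)
    have G: "G = Q * (N powr (p / q) * A powr (1 - p / q))"
      using K_pos \<kappa>0 N A by (simp add: G_def a_def b_def Q_def powr_mult mult_ac)
    obtain \<rho> where \<rho>: "0 < \<rho>" "\<And>k. a * u (\<rho> / 2 ^ k) powr \<alpha> \<le> G * (\<eta> powr \<alpha>) ^ k"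
        "\<And>k. b * u (2 ^ Suc k * \<rho>) powr - \<beta> \<le> G * (\<eta> powr \<beta>) ^ k"
      using Hedberg_splitting[of u \<eta> \<alpha> \<beta> a b] u uu \<eta> ab ab0 unfolding ab(3,4) G_def[symmetric] by auto
    have "riesz_int \<gamma> f x \<le>
      (\<Sum>k. ennreal (2 powr \<gamma> * (\<rho> / 2 ^ k) powr - \<gamma>) * (\<integral>\<^sup>+y\<in>ball x (\<rho> / 2 ^ k). f y \<partial>lebesgue)) +
      (\<Sum>k. ennreal (2 powr \<gamma> * (2 ^ Suc k * \<rho>) powr - \<gamma>) * (\<integral>\<^sup>+y\<in>ball x (2 ^ Suc k * \<rho>). f y \<partial>lebesgue))"
      by (rule riesz_int_le_series[OF \<rho>(1) \<gamma>0 assms(5)])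
    also have "\<dots> \<le> (\<Sum>k. ennreal (2 powr \<gamma> * G * (\<eta> powr \<alpha>) ^ k)) + (\<Sum>k. ennreal (2 powr \<gamma> * G * (\<eta> powr \<beta>) ^ k))"
    proof (intro add_mono suminf_le summableI)
      fix k
      have "ennreal (2 powr \<gamma> * (\<rho> / 2 ^ k) powr - \<gamma>) * (\<integral>\<^sup>+y\<in>ball x (\<rho> / 2 ^ k). f y \<partial>lebesgue) \<le>
          ennreal (2 powr \<gamma> * (K * \<kappa>0 * u (\<rho> / 2 ^ k) powr \<alpha>)) * ennreal N"
        using I1[of "\<rho> / 2 ^ k"] \<rho>(1) by (simp add: N)
      also have "\<dots> = ennreal (2 powr \<gamma> * (a * u (\<rho> / 2 ^ k) powr \<alpha>))"
        using N K_pos \<kappa>0 by (simp add: a_def mult_ac flip: ennreal_mult)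
      also have "\<dots> \<le> ennreal (2 powr \<gamma> * G * (\<eta> powr \<alpha>) ^ k)"
        using \<rho>(2)[of k] by (intro ennreal_leI) simp
      finally show "ennreal (2 powr \<gamma> * (\<rho> / 2 ^ k) powr - \<gamma>) * (\<integral>\<^sup>+y\<in>ball x (\<rho> / 2 ^ k). f y \<partial>lebesgue) \<le> \<dots>" .
      have "ennreal (2 powr \<gamma> * (2 ^ Suc k * \<rho>) powr - \<gamma>) * (\<integral>\<^sup>+y\<in>ball x (2 ^ Suc k * \<rho>). f y \<partial>lebesgue) \<le>
          ennreal (2 powr \<gamma> * (K powr (1 - 1 / p) * \<kappa>0 * A * u (2 ^ Suc k * \<rho>) powr - \<beta>))"
        using \<rho>(1) by (intro I2) simp
      also have "\<dots> \<le> ennreal (2 powr \<gamma> * G * (\<eta> powr \<beta>) ^ k)"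
        using \<rho>(3)[of k] by (intro ennreal_leI) (simp add: b_def)
      finally show "ennreal (2 powr \<gamma> * (2 ^ Suc k * \<rho>) powr - \<gamma>) * (\<integral>\<^sup>+y\<in>ball x (2 ^ Suc k * \<rho>). f y \<partial>lebesgue) \<le> \<dots>" .
    qed
    also have "\<dots> = ennreal (2 powr \<gamma> * G * Z)"
    proof -
      have "(\<Sum>k. ennreal (2 powr \<gamma> * G * (\<eta> powr \<alpha>) ^ k)) = ennreal (2 powr \<gamma> * G / (1 - \<eta> powr \<alpha>))"
        "(\<Sum>k. ennreal (2 powr \<gamma> * G * (\<eta> powr \<beta>) ^ k)) = ennreal (2 powr \<gamma> * G / (1 - \<eta> powr \<beta>))"
        using G0 \<eta>ab by (intro suminf_geometric_ennreal; simp)+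
      then show ?thesis
        using G0 \<eta>ab by (simp add: Z_def distrib_left flip: ennreal_plus)
    qed
    also have "2 powr \<gamma> * G * Z = C * A powr (1 - p / q) * N powr (p / q)"
      by (simp add: C G mult_ac)
    also have "N powr (p / q) = L powr ((1 + e) / q)"
      using p by (simp add: N_def powr_powr)
    also have "ennreal (C * A powr (1 - p / q) * L powr ((1 + e) / q)) =
        ennreal (C * A powr (1 - p / q)) * epowr (lerner_maximal p f x) ((1 + e) / q)"
      using 3 Q Z by (simp add: C epowr_ennreal ennreal_mult)
    finally show ?thesis .
  qed
qed

text \<open>Raising the pointwise bound to the power \<open>q\<close> leaves exactly the power \<open>1 + e\<close> of the maximal function that
  is controlled by the \<open>p\<close>-th power of \<open>f\<close>. For \<open>w = v\<^sup>q\<close> the density on the side of \<open>f\<close> is \<open>v\<^sup>p\<close>.\<close>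

theorem Muckenhoupt_Wheeden:
  assumes p: "1 < p" "p < q" and e: "e * (1 - 1 / p) = 1 / q"
    and \<gamma>: "\<gamma> = DIM('a) * (1 - 1 / p + 1 / q)"
    and [measurable]: "f \<in> borel_measurable lebesgue"
    and A: "0 < A" "(\<integral>\<^sup>+x. epowr (f x) p * ennreal (w x powr (e * (p - 1))) \<partial>lebesgue) \<le> ennreal (A powr p)"
  defines "C \<equiv> hedberg_const DIM('a) (ball_const TYPE('a)) e K p q \<gamma>"
  shows "(\<integral>\<^sup>+x. epowr (riesz_int \<gamma> f x) q * ennreal (w x) \<partial>lebesgue) \<le> ennreal (C powr q * lerner_const DIM('a) e K p * A powr q)"
proof -
  have C0: "0 \<le> C"
  proof -
    have "0 < reverse_doubling_const e K" "reverse_doubling_const e K < 1" using reverse_doubling_const_bounds by auto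
    moreover have "0 < 1 / p - 1 / q" "0 < 1 / q" using p by (auto simp: field_simps)
    ultimately have "reverse_doubling_const e K powr (1 / p - 1 / q) < 1" "reverse_doubling_const e K powr (1 / q) < 1"
      using powr_less_mono2[of _ "reverse_doubling_const e K" 1] by simp_all
    then show ?thesis unfolding C_def hedberg_const_def by auto
  qed
  have lc: "0 \<le> lerner_const DIM('a) e K p" using p e_pos by (auto simp: lerner_const_def doubling_const_def)
  have "(\<integral>\<^sup>+x. epowr (riesz_int \<gamma> f x) q * ennreal (w x) \<partial>lebesgue) \<le>
     (\<integral>\<^sup>+x. ennreal ((C * A powr (1 - p / q)) powr q) * (epowr (lerner_maximal p f x) (1 + e) * ennreal (w x)) \<partial>lebesgue)"
  proof (intro nn_integral_mono)
    fix x
    have "epowr (riesz_int \<gamma> f x) q \<le> epowr (ennreal (C * A powr (1 - p / q)) * epowr (lerner_maximal p f x) ((1 + e) / q)) q"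
      unfolding C_def using p by (intro epowr_mono riesz_int_le_lerner assms) auto
    also have "\<dots> = ennreal ((C * A powr (1 - p / q)) powr q) * epowr (lerner_maximal p f x) (1 + e)"
      using p C0 by (simp add: epowr_mult epowr_epowr epowr_ennreal)
    finally have "epowr (riesz_int \<gamma> f x) q * ennreal (w x) \<le> ennreal ((C * A powr (1 - p / q)) powr q) * epowr (lerner_maximal p f x) (1 + e) * ennreal (w x)"
      by (rule mult_right_mono) simp
    then show "epowr (riesz_int \<gamma> f x) q * ennreal (w x) \<le> ennreal ((C * A powr (1 - p / q)) powr q) * (epowr (lerner_maximal p f x) (1 + e) * ennreal (w x))"
      by (simp only: mult.assoc)
  qed
  also have "\<dots> = ennreal ((C * A powr (1 - p / q)) powr q) * (\<integral>\<^sup>+x. epowr (lerner_maximal p f x) (1 + e) * ennreal (w x) \<partial>lebesgue)"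
    by (rule nn_integral_cmult) measurable
  also have "(\<integral>\<^sup>+x. epowr (lerner_maximal p f x) (1 + e) * ennreal (w x) \<partial>lebesgue) = (\<integral>\<^sup>+x. epowr (lerner_maximal p f x) (1 + e) \<partial>W)"
    by (rule nn_integral_weighted[symmetric]) measurable
  also have "\<dots> \<le> ennreal (lerner_const DIM('a) e K p) * ennreal (A powr p)"
    using lerner_strong_type[OF p(1) assms(5)] mult_left_mono[OF A(2), of "ennreal (lerner_const DIM('a) e K p)"]
    by (meson order_trans zero_le)
  also have "ennreal ((C * A powr (1 - p / q)) powr q) * (ennreal (lerner_const DIM('a) e K p) * ennreal (A powr p)) =
      ennreal ((C * A powr (1 - p / q)) powr q * (lerner_const DIM('a) e K p * A powr p))"
    using lc by (simp flip: ennreal_mult)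
  also have "(C * A powr (1 - p / q)) powr q * (lerner_const DIM('a) e K p * A powr p) = C powr q * lerner_const DIM('a) e K p * (A powr ((1 - p / q) * q) * A powr p)"
    using C0 by (simp add: powr_mult powr_powr mult_ac)
  also have "A powr ((1 - p / q) * q) * A powr p = A powr q"
    using p by (simp add: field_simps flip: powr_add)
  finally show ?thesis by (simp add: mult_left_mono)
qed

end

section \<open>Riesz potentials and cubes\<close>

lemma sigma_finite_lebesgue: "sigma_finite_measure (lebesgue :: 'a::euclidean_space measure)"
  by (rule sigma_finite_if_balls_finite) (auto simp: emeasure_ball_eq)

lemma measurable_riesz_int [measurable]:
  assumes [measurable]: "f \<in> borel_measurable lebesgue"
  shows "riesz_int \<gamma> f \<in> borel_measurable lebesgue"
proof -
  interpret sigma_finite_measure "lebesgue :: 'a measure"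
    by (rule sigma_finite_lebesgue)
  have id [measurable]: "(\<lambda>x. x) \<in> lebesgue \<rightarrow>\<^sub>M (borel :: 'a measure)"
    by (rule measurable_completion) simp
  have "(\<lambda>z. fst z) \<in> (lebesgue \<Otimes>\<^sub>M lebesgue) \<rightarrow>\<^sub>M (borel :: 'a measure)" "(\<lambda>z. snd z) \<in> (lebesgue \<Otimes>\<^sub>M lebesgue) \<rightarrow>\<^sub>M (borel :: 'a measure)"
    using measurable_compose[OF measurable_fst id] measurable_compose[OF measurable_snd id] by auto
  then have "(\<lambda>z. ennreal (norm (fst z - snd z) powr - \<gamma>) * f (snd z)) \<in> borel_measurable (lebesgue \<Otimes>\<^sub>M lebesgue)"
    by measurable
  then have "case_prod (\<lambda>x y. ennreal (norm (x - y) powr - \<gamma>) * f y) \<in> borel_measurable (lebesgue \<Otimes>\<^sub>M lebesgue)"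
    by (simp add: case_prod_beta')
  then show ?thesis unfolding riesz_int_def by (rule borel_measurable_nn_integral)
qed

lemma riesz_int_add:
  assumes [measurable]: "f \<in> borel_measurable lebesgue" "g \<in> borel_measurable lebesgue"
  shows "riesz_int \<gamma> (\<lambda>y. f y + g y) x = riesz_int \<gamma> f x + riesz_int \<gamma> g x"
proof -
  have id [measurable]: "(\<lambda>x. x) \<in> lebesgue \<rightarrow>\<^sub>M (borel :: 'a measure)"
    by (rule measurable_completion) simp
  show ?thesis
    unfolding riesz_int_def distrib_left by (rule nn_integral_add) measurable
qed

lemma riesz_kernel_eq: "riesz_kernel s x y = norm (x - y) powr - (real CARD('d) - s)" for x :: "real^'d"
  unfolding riesz_kernel_def powr_minus_divide ..

lemma norm_riesz_potential_le:
  fixes f :: "real^'d \<Rightarrow> complex"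
  assumes [measurable]: "f \<in> borel_measurable lebesgue"
  shows "ennreal (norm (riesz_potential s f x)) \<le> riesz_int (real CARD('d) - s) (\<lambda>y. ennreal (norm (f y))) x"
proof (cases "integrable lebesgue (\<lambda>y. riesz_kernel s x y *\<^sub>R f y)")
  case True
  then have "ennreal (norm (riesz_potential s f x)) \<le> (\<integral>\<^sup>+y. ennreal (norm (riesz_kernel s x y *\<^sub>R f y)) \<partial>lebesgue)"
    unfolding riesz_potential_def by (rule integral_norm_bound_ennreal)
  then show ?thesis by (simp add: riesz_int_def riesz_kernel_eq ennreal_mult)
qed (simp add: riesz_potential_def not_integrable_integral_eq)

lemma integrable_riesz_kernel:
  fixes f :: "real^'d \<Rightarrow> complex"
  assumes [measurable]: "f \<in> borel_measurable lebesgue"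
    and "riesz_int (real CARD('d) - s) (\<lambda>y. ennreal (norm (f y))) x < top"
  shows "integrable lebesgue (\<lambda>y. riesz_kernel s x y *\<^sub>R f y)"
proof (rule integrableI_bounded)
  have id [measurable]: "(\<lambda>x. x) \<in> lebesgue \<rightarrow>\<^sub>M (borel :: (real^'d) measure)"
    by (rule measurable_completion) simp
  show "(\<lambda>y. riesz_kernel s x y *\<^sub>R f y) \<in> borel_measurable lebesgue"
    unfolding riesz_kernel_eq by measurable
  show "(\<integral>\<^sup>+y. ennreal (norm (riesz_kernel s x y *\<^sub>R f y)) \<partial>lebesgue) < \<infinity>"
    using assms(2) by (simp add: riesz_int_def riesz_kernel_eq ennreal_mult)
qed

lemma measure_cube:
  fixes a :: "real^'d" assumes "0 \<le> l"
  shows "measure lebesgue (cbox a (\<chi> i. a $ i + l)) = l ^ CARD('d)"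
proof -
  have "cbox a (\<chi> i. a $ i + l) \<noteq> {}" using assms by (simp add: interval_ne_empty_cart)
  then show ?thesis using content_cbox_cart[of a "\<chi> i. a $ i + l"] by simp
qed

lemma emeasure_cube:
  fixes a :: "real^'d" assumes "0 \<le> l"
  shows "emeasure lebesgue (cbox a (\<chi> i. a $ i + l)) = ennreal (l ^ CARD('d))"
  using measure_cube[OF assms, of a] emeasure_lborel_cbox_finite[of a "\<chi> i. a $ i + l"]
  by (subst emeasure_eq_ennreal_measure) auto

lemma ball_subset_cube: "ball z r \<subseteq> cbox (\<chi> i. z $ i - r) (\<chi> i. (\<chi> i. z $ i - r) $ i + 2 * r)" for z :: "real^'d"
proof
  fix x assume "x \<in> ball z r"
  then have "\<bar>(z - x) $ i\<bar> \<le> r" for i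
    using component_le_norm_cart[of "z - x" i] by (simp add: dist_norm)
  then show "x \<in> cbox (\<chi> i. z $ i - r) (\<chi> i. (\<chi> i. z $ i - r) $ i + 2 * r)"
    by (auto simp: mem_box_cart abs_le_iff algebra_simps)
qed

lemma cube_norm_le:
  fixes a :: "real^'d" and l :: real
  assumes "x \<in> cbox a (\<chi> i. a $ i + l)"
  shows "norm (x - (\<chi> i. a $ i + l / 2)) \<le> CARD('d) * l / 2"
proof -
  have "norm (x - (\<chi> i. a $ i + l / 2)) \<le> (\<Sum>i\<in>UNIV. \<bar>(x - (\<chi> i. a $ i + l / 2)) $ i\<bar>)"
    by (rule norm_le_l1_cart)
  also have "\<dots> \<le> (\<Sum>i\<in>(UNIV :: 'd set). l / 2)"
  proof (rule sum_mono)
    fix i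
    have "a $ i \<le> x $ i" "x $ i \<le> a $ i + l" using assms by (auto simp: mem_box_cart)
    then show "\<bar>(x - (\<chi> i. a $ i + l / 2)) $ i\<bar> \<le> l / 2"
      by (simp add: abs_le_iff field_simps)
  qed
  finally show ?thesis by simp
qed

text \<open>The inclusion of \<open>L\<^sup>t\<close> in \<open>L\<^sup>s\<close> on a set of finite measure.\<close>

lemma nn_integral_powr_subset:
  assumes [measurable]: "g \<in> borel_measurable lebesgue" "E \<in> sets lebesgue"
    and m: "emeasure lebesgue E = ennreal m" "0 \<le> m" and st: "0 < s" "s \<le> t"
  shows "(\<integral>\<^sup>+x\<in>E. epowr (g x) s \<partial>lebesgue) \<le> epowr (\<integral>\<^sup>+x\<in>E. epowr (g x) t \<partial>lebesgue) (s / t) * ennreal (m powr (1 - s / t))"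
proof (cases "s = t")
  case True
  then show ?thesis
  proof (cases "m = 0")
    case True
    then have "AE x in lebesgue. x \<notin> E" using m by (simp add: AE_iff_null null_sets_def)
    then have "(\<integral>\<^sup>+x\<in>E. epowr (g x) s \<partial>lebesgue) = (\<integral>\<^sup>+x. 0 \<partial>(lebesgue :: 'a measure))"
      by (intro nn_integral_cong_AE, eventually_elim) simp
    then show ?thesis by simp
  qed (use st in simp)
next
  case False
  have "(\<integral>\<^sup>+x\<in>E. epowr (g x) s \<partial>lebesgue) =
     (\<integral>\<^sup>+x. epowr (epowr (g x) t * indicator E x) (s / t) * epowr (indicator E x) (1 - s / t) \<partial>lebesgue)"
    using st by (intro nn_integral_cong) (auto simp: indicator_def epowr_epowr)
  also have "\<dots> \<le> epowr (\<integral>\<^sup>+x\<in>E. epowr (g x) t \<partial>lebesgue) (s / t) * epowr (\<integral>\<^sup>+x. indicator E x \<partial>lebesgue) (1 - s / t)"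
    using st False by (intro nn_integral_Hoelder) auto
  finally show ?thesis using m by (simp add: epowr_ennreal)
qed

section \<open>From the supremum over cubes to weights on balls\<close>

locale fractional_exponents =
  fixes n :: nat and lam p1 p2 q1 q2 p1' :: real
  assumes n_pos: "0 < n" and lam: "0 < lam" "lam < real n"
    and p1: "1 < p1" "p1 < real n / lam"
    and q1: "p1 \<le> q1" "q1 < real n / lam"
    and p12: "1 / p1 - 1 / p2 = lam / real n"
    and q12: "1 / q1 - 1 / q2 = lam / real n"
    and p1': "1 / p1' = 1 - 1 / p1"
begin

lemma p2_pos: "0 < p2" and p1_less_p2: "p1 < p2"
proof -
  have "lam / real n < 1 / p1" using p1 lam n_pos by (simp add: field_simps)
  then have "0 < 1 / p2" using p12 by linarith
  then show p2: "0 < p2" by simp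
  have "1 / p2 < 1 / p1" using p12 lam n_pos by (smt (verit) divide_pos_pos of_nat_0_less_iff)
  then show "p1 < p2" using p2 p1 by (simp add: field_simps)
qed

lemma q2_pos: "0 < q2" and p2_le_q2: "p2 \<le> q2"
proof -
  have "lam / real n < 1 / q1" using p1 q1 lam n_pos by (simp add: field_simps)
  then have "0 < 1 / q2" using q12 by linarith
  then show q2: "0 < q2" by simp
  have "1 / q1 \<le> 1 / p1" using p1 q1 by (simp add: field_simps)
  then have "1 / q2 \<le> 1 / p2" using p12 q12 by linarith
  then show "p2 \<le> q2" using q2 p2_pos by (simp add: field_simps)
qed

lemma p1'_pos: "0 < p1'" and p1'_eq: "p1' * (1 - 1 / p1) = 1"
proof -
  have "0 < 1 / p1'" unfolding p1' using p1 by simp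
  then show "0 < p1'" by simp
  then show "p1' * (1 - 1 / p1) = 1" unfolding p1'[symmetric] by simp
qed

lemma p1'_mult: "p1' * (p1 - 1) = p1"
  using p1'_eq p1 by (simp add: field_simps)

lemma gap: "1 / p1 - 1 / q1 = 1 / p2 - 1 / q2"
  using p12 q12 by linarith

lemma delta: "1 - lam / real n - 1 / p1 + 1 / q1 = 1 / q2 + 1 / p1'"
  using p1' q12 by linarith

lemma gamma: "real n - lam = real n * (1 - 1 / p1 + 1 / p2)"
proof -
  have "1 - 1 / p1 + 1 / p2 = 1 - lam / real n" using p12 by linarith
  then show ?thesis unfolding \<open>1 - 1 / p1 + 1 / p2 = _\<close> using n_pos by (simp add: right_diff_distrib)
qed

end

text \<open>A weight may vanish or be negative on a null set. Here it is positive everywhere, and the general case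
  is reduced to this one at the end.\<close>

locale fractional_weight = fractional_exponents "CARD('d)" lam p1 p2 q1 q2 p1'
  for lam p1 p2 q1 q2 p1' :: real and v :: "real^'d \<Rightarrow> real" and K :: real +
  assumes v_meas [measurable]: "v \<in> borel_measurable lebesgue"
    and v_pos: "0 < v x"
    and K_pos: "0 < K"
    and weight_const_le: "weight_const lam p1 p1' q1 q2 v \<le> ennreal K"
begin

abbreviation V :: "real \<Rightarrow> (real^'d) measure" where "V t \<equiv> weighted (\<lambda>x. v x powr t)"

lemma emeasure_V:
  assumes [measurable]: "E \<in> sets lebesgue"
  shows "emeasure (V t) E = (\<integral>\<^sup>+x\<in>E. epowr (ennreal (v x)) t \<partial>lebesgue)"
  using v_pos by (subst emeasure_weighted) (auto simp: epowr_ennreal less_imp_le)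

lemma V_Jensen:
  assumes "E \<in> sets lebesgue" "emeasure lebesgue E = ennreal m" "0 \<le> m" "0 < s" "s \<le> t"
  shows "emeasure (V s) E \<le> epowr (emeasure (V t) E) (s / t) * ennreal (m powr (1 - s / t))"
  using assms unfolding emeasure_V[OF assms(1)] by (intro nn_integral_powr_subset) auto

text \<open>
  Since \<open>1 - \<lambda>/d - 1/p\<^sub>1 + 1/q\<^sub>1 = 1/q\<^sub>2 + 1/p'\<^sub>1\<close>, the assumption on \<open>v\<close> is the Muckenhoupt condition for
  \<open>v\<close> to the power \<open>q\<^sub>2\<close>. By Jensen's inequality it is inherited by all smaller powers. The power
  \<open>p\<^sub>2\<close> serves the local part and the power \<open>q\<^sub>2\<close> the part far away.
\<close>

lemma cube_condition:
  fixes a :: "real^'d"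
  assumes l: "0 < l" and t: "0 < t" "t \<le> q2"
  defines "Q \<equiv> cbox a (\<chi> i. a $ i + l)"
  shows "epowr (emeasure (V t) Q) (p1' / t) * emeasure (V (- p1')) Q \<le> ennreal (K powr p1' * (l ^ CARD('d)) powr (1 + p1' / t))"
proof -
  define m where "m = l ^ CARD('d)"
  have m: "0 < m" "measure lebesgue Q = m" "emeasure lebesgue Q = ennreal m" and Qs [measurable]: "Q \<in> sets lebesgue"
    using l measure_cube[of l a] emeasure_cube[of l a] by (auto simp: m_def Q_def)
  have N1: "Lnorm q2 (\<lambda>x. v x * indicator Q x) = epowr (emeasure (V q2) Q) (1 / q2)"
    unfolding Lnorm_def emeasure_V[OF Qs]
    using v_pos q2_pos by (intro arg_cong[of _ _ "\<lambda>I. epowr I _"] nn_integral_cong)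
      (auto simp: indicator_def epowr_ennreal less_imp_le)
  have N2: "Lnorm p1' (\<lambda>x. inverse (v x) * indicator Q x) = epowr (emeasure (V (- p1')) Q) (1 / p1')"
    unfolding Lnorm_def emeasure_V[OF Qs]
    using v_pos p1'_pos by (intro arg_cong[of _ _ "\<lambda>I. epowr I _"] nn_integral_cong)
      (auto simp: indicator_def epowr_ennreal less_imp_le powr_minus inverse_powr)
  have "Q \<in> cubes" using l unfolding cubes_def Q_def by blast
  then have "ennreal (m powr - (1 / q2 + 1 / p1')) * epowr (emeasure (V q2) Q) (1 / q2) * epowr (emeasure (V (- p1')) Q) (1 / p1') \<le> weight_const lam p1 p1' q1 q2 v"
    unfolding weight_const_def delta N1[symmetric] N2[symmetric] m(2)[symmetric]
    by (intro SUP_upper)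
  then have "ennreal (m powr - (1 / q2 + 1 / p1')) * (epowr (emeasure (V q2) Q) (1 / q2) * epowr (emeasure (V (- p1')) Q) (1 / p1')) \<le> ennreal K"
    using weight_const_le by (simp add: mult.assoc)
  then have "ennreal (m powr (1 / q2 + 1 / p1')) * (ennreal (m powr - (1 / q2 + 1 / p1')) * (epowr (emeasure (V q2) Q) (1 / q2) * epowr (emeasure (V (- p1')) Q) (1 / p1')))
     \<le> ennreal (m powr (1 / q2 + 1 / p1')) * ennreal K"
    by (rule mult_left_mono) simp
  moreover have "ennreal (m powr (1 / q2 + 1 / p1')) * ennreal (m powr - (1 / q2 + 1 / p1')) = 1"
    using m(1) by (simp flip: ennreal_mult powr_add)
  ultimately have "epowr (emeasure (V q2) Q) (1 / q2) * epowr (emeasure (V (- p1')) Q) (1 / p1') \<le> ennreal (m powr (1 / q2 + 1 / p1') * K)"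
    using K_pos by (simp add: ennreal_mult flip: mult.assoc)
  then have "epowr (epowr (emeasure (V q2) Q) (1 / q2) * epowr (emeasure (V (- p1')) Q) (1 / p1')) p1' \<le> epowr (ennreal (m powr (1 / q2 + 1 / p1') * K)) p1'"
    using p1'_pos by (intro epowr_mono) auto
  also have "\<dots> = ennreal (K powr p1' * m powr (1 + p1' / q2))"
  proof -
    have ex: "(1 / q2 + 1 / p1') * p1' = 1 + p1' / q2" using p1'_pos by (simp add: distrib_right)
    have "(m powr (1 / q2 + 1 / p1') * K) powr p1' = m powr (1 + p1' / q2) * K powr p1'"
      using K_pos unfolding ex[symmetric] powr_powr[symmetric] by (simp add: powr_mult)
    then show ?thesis using K_pos by (simp add: epowr_ennreal mult.commute)
  qed
  finally have main: "epowr (emeasure (V q2) Q) (p1' / q2) * emeasure (V (- p1')) Q \<le> ennreal (K powr p1' * m powr (1 + p1' / q2))"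
    using p1'_pos by (simp add: epowr_mult epowr_epowr)
  have "epowr (emeasure (V t) Q) (p1' / t) \<le> epowr (epowr (emeasure (V q2) Q) (t / q2) * ennreal (m powr (1 - t / q2))) (p1' / t)"
    using t p1'_pos m by (intro epowr_mono V_Jensen) auto
  also have "\<dots> = epowr (emeasure (V q2) Q) (p1' / q2) * ennreal (m powr (p1' / t - p1' / q2))"
    using t q2_pos by (simp add: epowr_mult epowr_epowr epowr_ennreal powr_powr field_simps)
  finally have "epowr (emeasure (V t) Q) (p1' / t) * emeasure (V (- p1')) Q \<le>
      epowr (emeasure (V q2) Q) (p1' / q2) * ennreal (m powr (p1' / t - p1' / q2)) * emeasure (V (- p1')) Q"
    by (rule mult_right_mono) simp
  also have "\<dots> = ennreal (m powr (p1' / t - p1' / q2)) * (epowr (emeasure (V q2) Q) (p1' / q2) * emeasure (V (- p1')) Q)"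
    by (simp add: mult_ac)
  also have "\<dots> \<le> ennreal (m powr (p1' / t - p1' / q2)) * ennreal (K powr p1' * m powr (1 + p1' / q2))"
    by (rule mult_left_mono[OF main]) simp
  also have "\<dots> = ennreal (K powr p1' * m powr (1 + p1' / t))"
    using m(1) by (simp add: mult_ac flip: ennreal_mult powr_add)
  finally show ?thesis by (simp add: m_def)
qed

definition ball_Ap_const :: "real \<Rightarrow> real" where
  "ball_Ap_const t = K powr p1' * (2 ^ CARD('d) / ball_const TYPE(real^'d)) powr (1 + p1' / t)"

lemma ball_const_pos: "0 < ball_const TYPE(real^'d)"
  unfolding ball_const_def by (rule measure_ball_pos) simp

lemma measure_ball_eq: "0 \<le> r \<Longrightarrow> measure lebesgue (ball (x::real^'d) r) = r ^ CARD('d) * ball_const TYPE(real^'d)"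
  using content_ball_conv_unit_ball[of r x] by (simp add: ball_const_def)

lemma Ap_weight_V:
  assumes t: "0 < t" "t \<le> q2"
  shows "Ap_weight (\<lambda>x. v x powr t) (p1' / t) (ball_Ap_const t)"
proof
  fix r :: real and x :: "real^'d" assume r: "0 < r"
  define a where "a = (\<chi> i. x $ i - r)"
  define Q where "Q = cbox a (\<chi> i. a $ i + 2 * r)"
  have sub: "ball x r \<subseteq> Q" unfolding Q_def a_def by (rule ball_subset_cube)
  have Qs: "Q \<in> sets lebesgue" by (simp add: Q_def)
  have "(\<lambda>x. (v x powr t) powr - (p1' / t)) = (\<lambda>x. v x powr - p1')"
    using t by (simp add: powr_powr)
  then have "epowr (emeasure (V t) (ball x r)) (p1' / t) * emeasure (weighted (\<lambda>x. (v x powr t) powr - (p1' / t))) (ball x r)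
    \<le> epowr (emeasure (V t) Q) (p1' / t) * emeasure (V (- p1')) Q"
    using sub Qs t p1'_pos by (auto intro!: mult_mono epowr_mono emeasure_mono)
  also have "\<dots> \<le> ennreal (K powr p1' * ((2 * r) ^ CARD('d)) powr (1 + p1' / t))"
    unfolding Q_def using r t by (intro cube_condition) auto
  also have "(2 * r) ^ CARD('d) = 2 ^ CARD('d) / ball_const TYPE(real^'d) * measure lebesgue (ball x r)"
    using ball_const_pos unfolding measure_ball_eq[OF less_imp_le[OF r]] by (simp add: power_mult_distrib)
  also have "K powr p1' * \<dots> powr (1 + p1' / t) = ball_Ap_const t * measure lebesgue (ball x r) powr (1 + p1' / t)"
    using ball_const_pos by (subst powr_mult) (auto simp: ball_Ap_const_def)
  finally show "epowr (emeasure (V t) (ball x r)) (p1' / t) * emeasure (weighted (\<lambda>x. (v x powr t) powr - (p1' / t))) (ball x r) \<le>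
     ennreal (ball_Ap_const t * measure lebesgue (ball x r) powr (1 + p1' / t))" .
qed (use v_pos t p1'_pos K_pos ball_const_pos in \<open>auto simp: ball_Ap_const_def less_imp_neq[THEN not_sym]\<close>)

end

context fractional_weight
begin

section \<open>Local and far part\<close>

lemma norm_scaled_powr:
  "ennreal (norm (v x *\<^sub>R g) powr p) = epowr (ennreal (norm g)) p * ennreal (v x powr p)"
  using v_pos[of x] by (simp add: epowr_ennreal powr_mult mult.commute flip: ennreal_mult)

lemma cube_integral_le:
  fixes a :: "real^'d"
  assumes M: "0 \<le> M" "morrey_norm p1 q1 v f \<le> ennreal M" and l: "0 < l"
  shows "(\<integral>\<^sup>+x\<in>cbox a (\<chi> i. a $ i + l). ennreal (norm (v x *\<^sub>R f x) powr p1) \<partial>lebesgue)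
    \<le> ennreal (M powr p1 * (l ^ CARD('d)) powr (1 - p1 / q1))"
proof -
  define Q where "Q = cbox a (\<chi> i. a $ i + l)"
  define m where "m = l ^ CARD('d)"
  have m: "0 < m" "measure lebesgue Q = m" using l measure_cube[of l a] by (auto simp: m_def Q_def)
  define X where "X = (\<integral>\<^sup>+x\<in>Q. ennreal (norm (v x *\<^sub>R f x) powr p1) \<partial>lebesgue)"
  have "Q \<in> cubes" using l unfolding cubes_def Q_def by blast
  then have "ennreal (m powr (1 / q1)) * epowr (ennreal (1 / m) * X) (1 / p1) \<le> morrey_norm p1 q1 v f"
    unfolding morrey_norm_def X_def m(2)[symmetric] by (intro SUP_upper)
  then have "epowr (ennreal (m powr (1 / q1)) * epowr (ennreal (1 / m) * X) (1 / p1)) p1 \<le> epowr (ennreal M) p1"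
    using M p1 by (intro epowr_mono) auto
  then have "ennreal (m powr (p1 / q1)) * (ennreal (1 / m) * X) \<le> ennreal (M powr p1)"
    using M p1 by (simp add: epowr_mult epowr_epowr epowr_ennreal powr_powr)
  then have "ennreal (m powr (1 - p1 / q1)) * (ennreal (m powr (p1 / q1)) * (ennreal (1 / m) * X)) \<le> ennreal (m powr (1 - p1 / q1)) * ennreal (M powr p1)"
    by (rule mult_left_mono) simp
  moreover have "ennreal (m powr (1 - p1 / q1)) * (ennreal (m powr (p1 / q1)) * ennreal (1 / m)) = 1"
    using m(1) by (simp add: powr_diff flip: ennreal_mult)
  ultimately have "X \<le> ennreal (m powr (1 - p1 / q1)) * ennreal (M powr p1)"
    by (metis mult.assoc mult_1)
  then show ?thesis by (simp add: X_def Q_def m_def mult.commute flip: ennreal_mult)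
qed

lemma ball_integral_powr_le:
  assumes M: "0 \<le> M" "morrey_norm p1 q1 v f \<le> ennreal M" and r: "0 < r"
  shows "(\<integral>\<^sup>+x. epowr (ennreal (norm (f x)) * indicator (ball z r) x) p1 * ennreal (v x powr p1) \<partial>lebesgue)
    \<le> ennreal (M powr p1 * ((2 * r) ^ CARD('d)) powr (1 - p1 / q1))"
proof -
  define a where "a = (\<chi> i. z $ i - r)"
  have sub: "ball z r \<subseteq> cbox a (\<chi> i. a $ i + 2 * r)" unfolding a_def by (rule ball_subset_cube)
  have "(\<integral>\<^sup>+x. epowr (ennreal (norm (f x)) * indicator (ball z r) x) p1 * ennreal (v x powr p1) \<partial>lebesgue) \<le>
     (\<integral>\<^sup>+x\<in>cbox a (\<chi> i. a $ i + 2 * r). ennreal (norm (v x *\<^sub>R f x) powr p1) \<partial>lebesgue)"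
    unfolding norm_scaled_powr using sub
    by (intro nn_integral_mono) (auto simp: indicator_def)
  also have "\<dots> \<le> ennreal (M powr p1 * ((2 * r) ^ CARD('d)) powr (1 - p1 / q1))"
    using M r by (intro cube_integral_le) auto
  finally show ?thesis .
qed

definition local_const :: real where
  "local_const = hedberg_const CARD('d) (ball_const TYPE(real^'d)) (p1' / p2) (ball_Ap_const p2) p1 p2 (real CARD('d) - lam) powr p2 *
     lerner_const CARD('d) (p1' / p2) (ball_Ap_const p2) p1"

text \<open>On a ball the Morrey norm controls the weighted \<open>L\<close>-norm with exponent \<open>p\<^sub>1\<close>, and the weighted inequality
  applies. The powers of the radius agree because \<open>1/p\<^sub>1 - 1/q\<^sub>1 = 1/p\<^sub>2 - 1/q\<^sub>2\<close>.\<close>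

lemma local_part:
  assumes [measurable]: "f \<in> borel_measurable lebesgue"
    and M: "0 < M" "morrey_norm p1 q1 v f \<le> ennreal M" and R: "0 < R"
  shows "(\<integral>\<^sup>+x. epowr (riesz_int (real CARD('d) - lam) (\<lambda>y. ennreal (norm (f y)) * indicator (ball z R) y) x) p2 * ennreal (v x powr p2) \<partial>lebesgue)
    \<le> ennreal (local_const * (M powr p2 * ((2 * R) ^ CARD('d)) powr (1 - p2 / q2)))"
proof -
  interpret Ap_weight "\<lambda>x. v x powr p2" "p1' / p2" "ball_Ap_const p2"
    using p2_pos p2_le_q2 by (rule Ap_weight_V)
  let ?m = "(2 * R) ^ CARD('d)"
  define A where "A = M * ?m powr (1 / p1 - 1 / q1)"
  have A0: "0 < A" using M R by (simp add: A_def)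
  have Ap1: "A powr p1 = M powr p1 * ?m powr (1 - p1 / q1)"
    using M p1 by (simp add: A_def powr_mult powr_powr left_diff_distrib)
  have Ap2: "A powr p2 = M powr p2 * ?m powr (1 - p2 / q2)"
    using M p2_pos unfolding A_def gap by (simp add: powr_mult powr_powr left_diff_distrib)
  have ex: "p1' / p2 * (p1 - 1) * p2 = p1" "p2 * (p1' / p2 * (p1 - 1)) = p1"
    using p2_pos p1'_mult by auto
  have "(\<integral>\<^sup>+x. epowr (ennreal (norm (f x)) * indicator (ball z R) x) p1 * ennreal ((v x powr p2) powr (p1' / p2 * (p1 - 1))) \<partial>lebesgue)
     \<le> ennreal (A powr p1)"
    unfolding powr_powr ex Ap1 using M R by (intro ball_integral_powr_le) auto
  then have "(\<integral>\<^sup>+x. epowr (riesz_int (real CARD('d) - lam) (\<lambda>y. ennreal (norm (f y)) * indicator (ball z R) y) x) p2 * ennreal (v x powr p2) \<partial>lebesgue)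
     \<le> ennreal (hedberg_const DIM(real^'d) (ball_const TYPE(real^'d)) (p1' / p2) (ball_Ap_const p2) p1 p2 (real CARD('d) - lam) powr p2 *
     lerner_const DIM(real^'d) (p1' / p2) (ball_Ap_const p2) p1 * A powr p2)"
    using p1 p1_less_p2 p1'_eq gamma A0 p2_pos by (intro Muckenhoupt_Wheeden) auto
  then show ?thesis by (simp add: local_const_def Ap2)
qed

definition ball_integral_const :: real where
  "ball_integral_const = ball_Ap_const q2 powr (1 / p1') * ball_const TYPE(real^'d) powr (1 / p1' + 1 / q2)
     * 2 powr (CARD('d) * (1 / p1 - 1 / q1))"

text \<open>The Muckenhoupt condition with exponent \<open>q\<^sub>2\<close> trades the dual weight, which Hoelder's inequality produces,
  for a negative power of the weight itself; what remains of the radius is precisely the inverse of the kernel.\<close>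

lemma ball_integral_le:
  assumes [measurable]: "f \<in> borel_measurable lebesgue"
    and M: "0 < M" "morrey_norm p1 q1 v f \<le> ennreal M" and r: "0 < r"
  shows "(\<integral>\<^sup>+y\<in>ball z r. ennreal (norm (f y)) \<partial>lebesgue) \<le>
    ennreal (ball_integral_const * r powr (real CARD('d) - lam) * M * measure (V q2) (ball z r) powr - (1 / q2))"
proof -
  interpret Ap_weight "\<lambda>x. v x powr q2" "p1' / q2" "ball_Ap_const q2"
    using q2_pos by (intro Ap_weight_V) auto
  let ?n = "real CARD('d)"
  define g where "g = 1 / p1 - 1 / q1"
  define \<delta> where "\<delta> = 1 / p1' + 1 / q2"
  have ex: "1 - 1 / p1 = 1 / p1'" "p1' / q2 * (1 / p1') = 1 / q2" "(1 + p1' / q2) * (1 / p1') = \<delta>"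
    by (rule p1'[symmetric]) (use p1'_pos in \<open>simp_all add: \<delta>_def add_divide_distrib\<close>)
  have ex2: "q2 * (p1' / q2 * (p1 - 1)) = p1"
    using q2_pos p1'_mult by auto
  have g: "(1 - p1 / q1) * (1 / p1) = g" using p1 by (simp add: g_def diff_divide_distrib)
  have sum_exp: "?n * \<delta> + ?n * g = (real CARD('d) - lam)"
  proof -
    have "\<delta> + g = 1 - lam / ?n" using p1' q12 unfolding \<delta>_def g_def by linarith
    then have "?n * (\<delta> + g) = ?n * (1 - lam / ?n)" by simp
    then show ?thesis by (simp add: algebra_simps)
  qed
  have "(\<integral>\<^sup>+y\<in>ball z r. ennreal (norm (f y)) \<partial>lebesgue) = (\<integral>\<^sup>+y\<in>ball z r. ennreal (norm (f y)) * indicator (ball z r) y \<partial>lebesgue)"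
    by (intro nn_integral_cong) (simp add: indicator_def)
  also have "\<dots> \<le> ennreal (ball_Ap_const q2 powr (1 / p1') * measure lebesgue (ball z r) powr \<delta> * measure (V q2) (ball z r) powr - (1 / q2))
      * epowr (\<integral>\<^sup>+x. epowr (ennreal (norm (f x)) * indicator (ball z r) x) p1 * ennreal (v x powr p1) \<partial>lebesgue) (1 / p1)"
    using integral_ball_le_Hoelder[OF r p1(1), of "\<lambda>x. ennreal (norm (f x)) * indicator (ball z r) x" z]
    unfolding ex powr_powr ex2 by simp
  also have "\<dots> \<le> ennreal (ball_Ap_const q2 powr (1 / p1') * measure lebesgue (ball z r) powr \<delta> * measure (V q2) (ball z r) powr - (1 / q2))
      * epowr (ennreal (M powr p1 * ((2 * r) ^ CARD('d)) powr (1 - p1 / q1))) (1 / p1)"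
    using M r p1 by (intro mult_left_mono epowr_mono ball_integral_powr_le) auto
  also have "epowr (ennreal (M powr p1 * ((2 * r) ^ CARD('d)) powr (1 - p1 / q1))) (1 / p1) = ennreal (M * ((2 * r) ^ CARD('d)) powr g)"
    using M p1 unfolding g[symmetric] by (simp add: epowr_ennreal powr_mult powr_powr)
  also have "ennreal (ball_Ap_const q2 powr (1 / p1') * measure lebesgue (ball z r) powr \<delta> * measure (V q2) (ball z r) powr - (1 / q2)) *
      ennreal (M * ((2 * r) ^ CARD('d)) powr g) =
     ennreal (ball_Ap_const q2 powr (1 / p1') * measure lebesgue (ball z r) powr \<delta> * measure (V q2) (ball z r) powr - (1 / q2) * (M * ((2 * r) ^ CARD('d)) powr g))"
    using M by (intro ennreal_mult[symmetric]) auto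
  also have "measure lebesgue (ball z r) powr \<delta> = r powr (?n * \<delta>) * ball_const TYPE(real^'d) powr \<delta>"
    using r ball_const_pos unfolding measure_ball_eq[OF less_imp_le[OF r]] by (simp add: powr_mult powr_powr flip: powr_realpow)
  also have "((2 * r) ^ CARD('d)) powr g = 2 powr (?n * g) * r powr (?n * g)"
    using r by (simp add: powr_mult powr_powr flip: powr_realpow)
  also have "ball_Ap_const q2 powr (1 / p1') * (r powr (?n * \<delta>) * ball_const TYPE(real^'d) powr \<delta>) * measure (V q2) (ball z r) powr - (1 / q2) *
       (M * (2 powr (?n * g) * r powr (?n * g))) =
     ball_integral_const * (r powr (?n * \<delta>) * r powr (?n * g)) * M * measure (V q2) (ball z r) powr - (1 / q2)"
    by (simp add: ball_integral_const_def \<delta>_def g_def mult_ac)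
  also have "r powr (?n * \<delta>) * r powr (?n * g) = r powr (real CARD('d) - lam)" by (simp add: sum_exp flip: powr_add)
  finally show ?thesis .
qed

definition far_const :: real where
  "far_const = 4 powr (real CARD('d) - lam) * ball_integral_const / (1 - reverse_doubling_const (p1' / q2) (ball_Ap_const q2) powr (1 / q2))"

text \<open>Each dyadic annulus contributes the inverse \<open>L\<close>-norm of \<open>v\<close>, with exponent \<open>q\<^sub>2\<close>, over a dilated ball.
  Reverse doubling makes the sum geometric, dominated by the undilated ball.\<close>

lemma far_part:
  assumes [measurable]: "f \<in> borel_measurable lebesgue"
    and M: "0 < M" "morrey_norm p1 q1 v f \<le> ennreal M" and R: "0 < R" and x: "norm (x - z) \<le> R / 2"
  shows "riesz_int (real CARD('d) - lam) (\<lambda>y. ennreal (norm (f y)) * indicator (- ball z R) y) x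
    \<le> ennreal (far_const * M * measure (V q2) (ball z R) powr - (1 / q2))"
proof -
  interpret Ap_weight "\<lambda>x. v x powr q2" "p1' / q2" "ball_Ap_const q2"
    using q2_pos by (intro Ap_weight_V) auto
  define \<eta> where "\<eta> = reverse_doubling_const (p1' / q2) (ball_Ap_const q2)"
  have \<eta>: "0 < \<eta>" "\<eta> < 1" using reverse_doubling_const_bounds by (auto simp: \<eta>_def)
  have \<eta>q: "\<eta> powr (1 / q2) < 1" using powr_less_mono2[of "1 / q2" \<eta> 1] \<eta> q2_pos by simp
  have gamma_pos: "0 < (real CARD('d) - lam)" using lam by simp
  define u where "u r = measure (V q2) (ball z r)" for r
  have u0: "0 < u r" if "0 < r" for r
    using W_ball_finite[of z r] W_ball_pos[OF that, of z] by (cases "emeasure (V q2) (ball z r)"; simp add: u_def measure_def)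
  define B where "B = ball_integral_const"
  have B: "0 \<le> B" by (simp add: B_def ball_integral_const_def)
  have "riesz_int (real CARD('d) - lam) (\<lambda>y. ennreal (norm (f y)) * indicator (- ball z R) y) x \<le>
     (\<integral>\<^sup>+y. ennreal (2 powr (real CARD('d) - lam)) * ((\<Sum>k. ennreal (2 powr (real CARD('d) - lam) * (2 ^ Suc k * R) powr - (real CARD('d) - lam)) * indicator (ball z (2 ^ Suc k * R)) y) * ennreal (norm (f y))) \<partial>lebesgue)"
    unfolding riesz_int_def
  proof (intro nn_integral_mono)
    fix y
    let ?s = "\<Sum>k. ennreal (2 powr (real CARD('d) - lam) * (2 ^ Suc k * R) powr - (real CARD('d) - lam)) * indicator (ball z (2 ^ Suc k * R)) y"
    show "ennreal (norm (x - y) powr - (real CARD('d) - lam)) * (ennreal (norm (f y)) * indicator (- ball z R) y) \<le> ennreal (2 powr (real CARD('d) - lam)) * (?s * ennreal (norm (f y)))"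
    proof (cases "y \<in> ball z R")
      case False
      then have zy: "R \<le> norm (z - y)" by (simp add: dist_norm)
      have "norm (z - y) \<le> norm (z - x) + norm (x - y)" using norm_triangle_ineq[of "z - x" "x - y"] by simp
      then have "norm (z - y) / 2 \<le> norm (x - y)" using x zy by (simp add: norm_minus_commute)
      then have "norm (x - y) powr - (real CARD('d) - lam) \<le> (norm (z - y) / 2) powr - (real CARD('d) - lam)"
        using zy R gamma_pos by (intro powr_mono2') auto
      also have "\<dots> = 2 powr (real CARD('d) - lam) * norm (z - y) powr - (real CARD('d) - lam)"
        by (rule half_powr_minus)
      finally have "ennreal (norm (x - y) powr - (real CARD('d) - lam)) \<le> ennreal (2 powr (real CARD('d) - lam)) * ennreal (norm (z - y) powr - (real CARD('d) - lam))"
        by (simp add: ennreal_leI flip: ennreal_mult)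
      also have "\<dots> \<le> ennreal (2 powr (real CARD('d) - lam)) * ?s"
        using zy R gamma_pos by (intro mult_left_mono kernel_far_le) auto
      finally have "ennreal (norm (x - y) powr - (real CARD('d) - lam)) * ennreal (norm (f y)) \<le> ennreal (2 powr (real CARD('d) - lam)) * ?s * ennreal (norm (f y))"
        by (rule mult_right_mono) simp
      then show ?thesis using False by (simp add: mult.assoc)
    qed simp
  qed
  also have "\<dots> = ennreal (2 powr (real CARD('d) - lam)) * (\<integral>\<^sup>+y. (\<Sum>k. ennreal (2 powr (real CARD('d) - lam) * (2 ^ Suc k * R) powr - (real CARD('d) - lam)) * indicator (ball z (2 ^ Suc k * R)) y) * ennreal (norm (f y)) \<partial>lebesgue)"
    by (rule nn_integral_cmult) measurable
  also have "(\<integral>\<^sup>+y. (\<Sum>k. ennreal (2 powr (real CARD('d) - lam) * (2 ^ Suc k * R) powr - (real CARD('d) - lam)) * indicator (ball z (2 ^ Suc k * R)) y) * ennreal (norm (f y)) \<partial>lebesgue) =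
      (\<Sum>k. ennreal (2 powr (real CARD('d) - lam) * (2 ^ Suc k * R) powr - (real CARD('d) - lam)) * (\<integral>\<^sup>+y\<in>ball z (2 ^ Suc k * R). ennreal (norm (f y)) \<partial>lebesgue))"
    by (rule nn_integral_ball_series) measurable
  also have "ennreal (2 powr (real CARD('d) - lam)) * (\<Sum>k. ennreal (2 powr (real CARD('d) - lam) * (2 ^ Suc k * R) powr - (real CARD('d) - lam)) * (\<integral>\<^sup>+y\<in>ball z (2 ^ Suc k * R). ennreal (norm (f y)) \<partial>lebesgue))
      \<le> ennreal (2 powr (real CARD('d) - lam)) * (\<Sum>k. ennreal (2 powr (real CARD('d) - lam) * B * M * u R powr - (1 / q2) * (\<eta> powr (1 / q2)) ^ k))"
  proof (intro mult_left_mono suminf_le summableI)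
    fix k
    let ?r = "2 ^ Suc k * R"
    have r: "0 < ?r" using R by simp
    have "u R \<le> \<eta> ^ Suc k * u ?r"
      using \<eta> R reverse_doubling[of _ z] by (intro le_iterated_doubling) (auto simp: u_def \<eta>_def)
    also have "\<dots> \<le> \<eta> ^ k * u ?r"
      using \<eta> u0[OF r] by (intro mult_right_mono power_decreasing) auto
    finally have "u R / \<eta> ^ k \<le> u ?r" using \<eta> by (simp add: field_simps)
    then have "u ?r powr - (1 / q2) \<le> (u R / \<eta> ^ k) powr - (1 / q2)"
      using u0[OF R] \<eta> q2_pos by (intro powr_mono2') auto
    also have "\<dots> = u R powr - (1 / q2) * (\<eta> powr (1 / q2)) ^ k"
      using \<eta> u0[OF R] by (simp add: powr_divide powr_minus powr_realpow[symmetric] powr_powr powr_power mult.commute field_simps)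
    finally have u_le: "u ?r powr - (1 / q2) \<le> u R powr - (1 / q2) * (\<eta> powr (1 / q2)) ^ k" .
    have "ennreal (2 powr (real CARD('d) - lam) * ?r powr - (real CARD('d) - lam)) * (\<integral>\<^sup>+y\<in>ball z ?r. ennreal (norm (f y)) \<partial>lebesgue) \<le>
       ennreal (2 powr (real CARD('d) - lam) * ?r powr - (real CARD('d) - lam)) * ennreal (B * ?r powr (real CARD('d) - lam) * M * u ?r powr - (1 / q2))"
      unfolding B_def u_def using M r by (intro mult_left_mono ball_integral_le) auto
    also have "\<dots> = ennreal (2 powr (real CARD('d) - lam) * ?r powr - (real CARD('d) - lam) * (B * ?r powr (real CARD('d) - lam) * M * u ?r powr - (1 / q2)))"
      using M B by (intro ennreal_mult[symmetric]) auto
    also have "2 powr (real CARD('d) - lam) * ?r powr - (real CARD('d) - lam) * (B * ?r powr (real CARD('d) - lam) * M * u ?r powr - (1 / q2)) =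
        2 powr (real CARD('d) - lam) * B * M * u ?r powr - (1 / q2) * (?r powr - (real CARD('d) - lam) * ?r powr (real CARD('d) - lam))"
      by (simp only: mult_ac)
    also have "?r powr - (real CARD('d) - lam) * ?r powr (real CARD('d) - lam) = 1" by (rule powr_minus_cancel[OF r])
    also have "ennreal (2 powr (real CARD('d) - lam) * B * M * u ?r powr - (1 / q2) * 1) \<le> ennreal (2 powr (real CARD('d) - lam) * B * M * u R powr - (1 / q2) * (\<eta> powr (1 / q2)) ^ k)"
      using mult_left_mono[OF u_le, of "2 powr (real CARD('d) - lam) * B * M"] B M by (intro ennreal_leI) (simp add: mult.assoc)
    finally show "ennreal (2 powr (real CARD('d) - lam) * ?r powr - (real CARD('d) - lam)) * (\<integral>\<^sup>+y\<in>ball z ?r. ennreal (norm (f y)) \<partial>lebesgue) \<le> \<dots>" .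
  qed simp
  also have "(\<Sum>k. ennreal (2 powr (real CARD('d) - lam) * B * M * u R powr - (1 / q2) * (\<eta> powr (1 / q2)) ^ k)) =
      ennreal (2 powr (real CARD('d) - lam) * B * M * u R powr - (1 / q2) / (1 - \<eta> powr (1 / q2)))"
    using B M \<eta>q by (intro suminf_geometric_ennreal) auto
  also have "ennreal (2 powr (real CARD('d) - lam)) * \<dots> = ennreal (2 powr (real CARD('d) - lam) * (2 powr (real CARD('d) - lam) * B * M * u R powr - (1 / q2) / (1 - \<eta> powr (1 / q2))))"
    using B M \<eta>q by (intro ennreal_mult[symmetric]) auto
  also have "2 powr (real CARD('d) - lam) * (2 powr (real CARD('d) - lam) * B * M * u R powr - (1 / q2) / (1 - \<eta> powr (1 / q2))) = far_const * M * u R powr - (1 / q2)"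
  proof -
    have "(4::real) powr (real CARD('d) - lam) = 2 powr (real CARD('d) - lam) * 2 powr (real CARD('d) - lam)" using powr_mult[of 2 2 "real CARD('d) - lam"] by simp
    then show ?thesis by (simp add: far_const_def B_def \<eta>_def)
  qed
  finally show ?thesis by (simp add: u_def)
qed

definition cube_const :: real where
  "cube_const = 2 powr p2 * (local_const * ((2 * real CARD('d)) ^ CARD('d)) powr (1 - p2 / q2) + far_const powr p2)"

lemma local_const_nonneg: "0 \<le> local_const"
  using p1 p1'_pos p2_pos by (auto simp: local_const_def lerner_const_def doubling_const_def)

lemma far_const_nonneg: "0 \<le> far_const"
proof -
  interpret Ap_weight "\<lambda>x. v x powr q2" "p1' / q2" "ball_Ap_const q2"
    using q2_pos by (intro Ap_weight_V) auto
  have "reverse_doubling_const (p1' / q2) (ball_Ap_const q2) powr (1 / q2) < 1"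
    using powr_less_mono2[of "1 / q2" "reverse_doubling_const (p1' / q2) (ball_Ap_const q2)" 1] reverse_doubling_const_bounds q2_pos by simp
  then show ?thesis by (simp add: far_const_def ball_integral_const_def)
qed

lemma cube_const_nonneg: "0 \<le> cube_const"
  using local_const_nonneg by (simp add: cube_const_def)

text \<open>
  The function is split at a ball about the centre of the cube, twice as large as needed to contain the
  cube. The distance of a point outside this ball to any point of the cube is then at least half its
  distance to the centre.
  The far part is bounded by a constant on the cube, which is then integrated against the weight.
\<close>

theorem cube_estimate:
  fixes a :: "real^'d"
  assumes f [measurable]: "f \<in> borel_measurable lebesgue"
    and M: "0 < M" "morrey_norm p1 q1 v f \<le> ennreal M" and l: "0 < l"
  defines "Q \<equiv> cbox a (\<chi> i. a $ i + l)"
  shows "(\<integral>\<^sup>+x\<in>Q. epowr (riesz_int (real CARD('d) - lam) (\<lambda>y. ennreal (norm (f y))) x) p2 * ennreal (v x powr p2) \<partial>lebesgue)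
    \<le> ennreal (cube_const * M powr p2 * (l ^ CARD('d)) powr (1 - p2 / q2))"
proof -
  interpret Ap_weight "\<lambda>x. v x powr q2" "p1' / q2" "ball_Ap_const q2"
    using q2_pos by (intro Ap_weight_V) auto
  define z where "z = (\<chi> i. a $ i + l / 2)"
  \<comment> \<open>Half of \<open>R\<close> bounds the distance of points of the cube from its centre, measured by the
    sum norm.\<close>
  define R where "R = real CARD('d) * l"
  have R: "0 < R" using l by (simp add: R_def)
  have Qz: "norm (x - z) \<le> R / 2" if "x \<in> Q" for x
    using cube_norm_le[of x a l] that by (simp add: Q_def z_def R_def)
  have sub: "Q \<subseteq> ball z R"
    using Qz R by (force simp: dist_norm norm_minus_commute)
  define m where "m = l ^ CARD('d)"
  have m: "0 < m" "emeasure lebesgue Q = ennreal m" and Qs [measurable]: "Q \<in> sets lebesgue"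
    using l emeasure_cube[of l a] by (auto simp: m_def Q_def)
  define f0 where "f0 y = ennreal (norm (f y)) * indicator (ball z R) y" for y
  define f1 where "f1 y = ennreal (norm (f y)) * indicator (- ball z R) y" for y
  have [measurable]: "f0 \<in> borel_measurable lebesgue" "f1 \<in> borel_measurable lebesgue"
    unfolding f0_def f1_def by measurable
  have f01: "(\<lambda>y. ennreal (norm (f y))) = (\<lambda>y. f0 y + f1 y)"
    by (auto simp: f0_def f1_def indicator_def)
  define u where "u = measure (V q2) (ball z R)"
  have u: "emeasure (V q2) (ball z R) = ennreal u" "0 < u"
    using W_ball_finite[of z R] W_ball_pos[OF R, of z] by (cases "emeasure (V q2) (ball z R)"; simp add: u_def measure_def)+
  define H where "H = far_const * M * u powr - (1 / q2)"
  have H: "0 \<le> H" using far_const_nonneg M by (simp add: H_def)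
  have far: "riesz_int (real CARD('d) - lam) f1 x \<le> ennreal H" if "x \<in> Q" for x
    using far_part[OF f M R Qz[OF that]] by (simp add: f1_def[abs_def] H_def u_def)
  let ?J = "\<lambda>x. epowr (riesz_int (real CARD('d) - lam) f0 x) p2 * ennreal (v x powr p2)"
  have "(\<integral>\<^sup>+x\<in>Q. epowr (riesz_int (real CARD('d) - lam) (\<lambda>y. ennreal (norm (f y))) x) p2 * ennreal (v x powr p2) \<partial>lebesgue) \<le>
     (\<integral>\<^sup>+x. ennreal (2 powr p2) * (?J x + ennreal (H powr p2) * (ennreal (v x powr p2) * indicator Q x)) \<partial>lebesgue)"
  proof (intro nn_integral_mono)
    fix x
    show "epowr (riesz_int (real CARD('d) - lam) (\<lambda>y. ennreal (norm (f y))) x) p2 * ennreal (v x powr p2) * indicator Q x \<le>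
       ennreal (2 powr p2) * (?J x + ennreal (H powr p2) * (ennreal (v x powr p2) * indicator Q x))"
    proof (cases "x \<in> Q")
      case True
      have "epowr (riesz_int (real CARD('d) - lam) (\<lambda>y. ennreal (norm (f y))) x) p2 = epowr (riesz_int (real CARD('d) - lam) f0 x + riesz_int (real CARD('d) - lam) f1 x) p2"
        unfolding f01 by (subst riesz_int_add) measurable
      also have "\<dots> \<le> epowr (riesz_int (real CARD('d) - lam) f0 x + ennreal H) p2"
        using far[OF True] p2_pos by (intro epowr_mono add_left_mono) auto
      also have "\<dots> \<le> ennreal (2 powr p2) * (epowr (riesz_int (real CARD('d) - lam) f0 x) p2 + ennreal (H powr p2))"
        using epowr_double_le[OF p2_pos, of "riesz_int (real CARD('d) - lam) f0 x" "ennreal H"] H by (simp add: epowr_ennreal)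
      finally have "epowr (riesz_int (real CARD('d) - lam) (\<lambda>y. ennreal (norm (f y))) x) p2 * ennreal (v x powr p2) \<le>
        ennreal (2 powr p2) * (epowr (riesz_int (real CARD('d) - lam) f0 x) p2 + ennreal (H powr p2)) * ennreal (v x powr p2)"
        by (rule mult_right_mono) simp
      then show ?thesis using True by (simp add: distrib_right mult.assoc)
    qed simp
  qed
  also have "\<dots> = ennreal (2 powr p2) * ((\<integral>\<^sup>+x. ?J x \<partial>lebesgue) + ennreal (H powr p2) * emeasure (V p2) Q)"
    by (subst nn_integral_cmult, measurable, subst nn_integral_add, measurable, subst nn_integral_cmult, measurable)
       (subst emeasure_weighted, measurable)
  also have "\<dots> \<le> ennreal (2 powr p2) * (ennreal (local_const * (M powr p2 * ((2 * R) ^ CARD('d)) powr (1 - p2 / q2))) +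
       ennreal (far_const powr p2 * M powr p2 * m powr (1 - p2 / q2)))"
  proof (intro mult_left_mono add_mono)
    show "(\<integral>\<^sup>+x. ?J x \<partial>lebesgue) \<le> ennreal (local_const * (M powr p2 * ((2 * R) ^ CARD('d)) powr (1 - p2 / q2)))"
      using local_part[OF f M R] by (simp add: f0_def[abs_def])
    have "emeasure (V p2) Q \<le> epowr (emeasure (V q2) Q) (p2 / q2) * ennreal (m powr (1 - p2 / q2))"
      using m p2_pos p2_le_q2 by (intro V_Jensen) auto
    also have "\<dots> \<le> epowr (ennreal u) (p2 / q2) * ennreal (m powr (1 - p2 / q2))"
      using sub p2_pos q2_pos unfolding u(1)[symmetric] by (intro mult_right_mono epowr_mono emeasure_mono) auto
    also have "\<dots> = ennreal (u powr (p2 / q2) * m powr (1 - p2 / q2))"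
      using u by (simp add: epowr_ennreal flip: ennreal_mult)
    finally have "ennreal (H powr p2) * emeasure (V p2) Q \<le> ennreal (H powr p2) * ennreal (u powr (p2 / q2) * m powr (1 - p2 / q2))"
      by (rule mult_left_mono) simp
    also have "\<dots> = ennreal (H powr p2 * (u powr (p2 / q2) * m powr (1 - p2 / q2)))"
      by (simp flip: ennreal_mult)
    also have "H powr p2 * (u powr (p2 / q2) * m powr (1 - p2 / q2)) = far_const powr p2 * M powr p2 * m powr (1 - p2 / q2)"
    proof -
      have "H powr p2 = far_const powr p2 * M powr p2 * u powr - (p2 / q2)"
        by (simp add: H_def powr_mult powr_powr)
      then have "H powr p2 * (u powr (p2 / q2) * m powr (1 - p2 / q2)) =
          far_const powr p2 * M powr p2 * (u powr - (p2 / q2) * u powr (p2 / q2)) * m powr (1 - p2 / q2)"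
        by (simp only: mult_ac)
      then show ?thesis unfolding powr_minus_cancel[OF u(2)] by simp
    qed
    finally show "ennreal (H powr p2) * emeasure (V p2) Q \<le> ennreal (far_const powr p2 * M powr p2 * m powr (1 - p2 / q2))" .
  qed simp
  also have "\<dots> = ennreal (2 powr p2 * (local_const * (M powr p2 * ((2 * R) ^ CARD('d)) powr (1 - p2 / q2)) +
       far_const powr p2 * M powr p2 * m powr (1 - p2 / q2)))"
    using local_const_nonneg by (simp flip: ennreal_mult ennreal_plus)
  also have "((2 * R) ^ CARD('d)) powr (1 - p2 / q2) = ((2 * real CARD('d)) ^ CARD('d)) powr (1 - p2 / q2) * m powr (1 - p2 / q2)"
  proof -
    have "(2 * R) ^ CARD('d) = (2 * real CARD('d)) ^ CARD('d) * m"
      by (simp add: R_def m_def power_mult_distrib)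
    then show ?thesis by (simp only: powr_mult)
  qed
  also have "2 powr p2 * (local_const * (M powr p2 * (((2 * real CARD('d)) ^ CARD('d)) powr (1 - p2 / q2) * m powr (1 - p2 / q2))) +
       far_const powr p2 * M powr p2 * m powr (1 - p2 / q2)) = cube_const * M powr p2 * m powr (1 - p2 / q2)"
    by (simp add: cube_const_def algebra_simps)
  finally show ?thesis by (simp add: m_def)
qed

end

section \<open>The Morrey space estimate\<close>

lemma UN_cubes_eq_UNIV: "(\<Union>k::nat. cbox (\<chi> i. - real (Suc k)) (\<chi> i. (\<chi> i. - real (Suc k)) $ i + 2 * real (Suc k))) = (UNIV :: (real^'d) set)"
proof (intro equalityI subsetI)
  fix x :: "real^'d"
  obtain k :: nat where k: "norm x \<le> real k" using real_arch_simple by blast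
  have "- real (Suc k) \<le> x $ i" "x $ i \<le> real (Suc k)" for i
    using component_le_norm_cart[of x i] k by (auto simp: abs_le_iff)
  then have "x \<in> cbox (\<chi> i. - real (Suc k)) (\<chi> i. (\<chi> i. - real (Suc k)) $ i + 2 * real (Suc k))"
    by (simp add: mem_box_cart)
  then show "x \<in> (\<Union>k::nat. cbox (\<chi> i. - real (Suc k)) (\<chi> i. (\<chi> i. - real (Suc k)) $ i + 2 * real (Suc k)))"
    by blast
qed simp

context fractional_weight
begin

lemma AE_riesz_int_finite:
  assumes f [measurable]: "f \<in> borel_measurable lebesgue"
    and M: "0 < M" "morrey_norm p1 q1 v f \<le> ennreal M"
  shows "AE x in lebesgue. riesz_int (real CARD('d) - lam) (\<lambda>y. ennreal (norm (f y))) x < top"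
proof -
  let ?J = "riesz_int (real CARD('d) - lam) (\<lambda>y. ennreal (norm (f y)))"
  define Q :: "nat \<Rightarrow> (real^'d) set" where
    "Q k = cbox (\<chi> i. - real (Suc k)) (\<chi> i. (\<chi> i. - real (Suc k)) $ i + 2 * real (Suc k))" for k
  have [measurable]: "Q k \<in> sets lebesgue" for k by (simp add: Q_def)
  have "AE x in lebesgue. x \<in> Q k \<longrightarrow> ?J x < top" for k
  proof -
    have "(\<integral>\<^sup>+x\<in>Q k. epowr (?J x) p2 * ennreal (v x powr p2) \<partial>lebesgue) < top"
      unfolding Q_def by (rule le_less_trans[OF cube_estimate[OF f M] ennreal_less_top]) simp
    then have "AE x in lebesgue. epowr (?J x) p2 * ennreal (v x powr p2) * indicator (Q k) x \<noteq> \<infinity>"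
      by (intro nn_integral_PInf_AE) auto
    then show ?thesis
    proof eventually_elim
      case (elim x)
      then show ?case using v_pos[of x]
        by (auto simp: ennreal_mult_eq_top_iff top.not_eq_extremum[symmetric] less_imp_neq[THEN not_sym])
    qed
  qed
  then have "AE x in lebesgue. \<forall>k. x \<in> Q k \<longrightarrow> ?J x < top" unfolding AE_all_countable by blast
  moreover have "\<exists>k. x \<in> Q k" for x using UN_cubes_eq_UNIV unfolding Q_def by blast
  ultimately show ?thesis by (auto elim!: eventually_mono)
qed

lemma morrey_norm_riesz_potential_le:
  assumes f [measurable]: "f \<in> borel_measurable lebesgue"
    and M: "0 < M" "morrey_norm p1 q1 v f \<le> ennreal M"
  shows "morrey_norm p2 q2 v (riesz_potential lam f) \<le> ennreal (cube_const powr (1 / p2) * M)"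
  unfolding morrey_norm_def
proof (rule SUP_least)
  fix Q :: "(real^'d) set" assume "Q \<in> cubes"
  then obtain a l where l: "0 < l" and Q: "Q = cbox a (\<chi> i. a $ i + l)" by (auto simp: cubes_def)
  define m where "m = l ^ CARD('d)"
  have m: "0 < m" "measure lebesgue Q = m" using l measure_cube[of l a] by (auto simp: m_def Q)
  have "(\<integral>\<^sup>+x\<in>Q. ennreal (norm (v x *\<^sub>R riesz_potential lam f x) powr p2) \<partial>lebesgue) \<le>
    (\<integral>\<^sup>+x\<in>Q. epowr (riesz_int (real CARD('d) - lam) (\<lambda>y. ennreal (norm (f y))) x) p2 * ennreal (v x powr p2) \<partial>lebesgue)"
    unfolding norm_scaled_powr using p2_pos
    by (intro nn_integral_mono mult_right_mono epowr_mono norm_riesz_potential_le) auto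
  also have "\<dots> \<le> ennreal (cube_const * M powr p2 * m powr (1 - p2 / q2))"
    unfolding Q m_def by (rule cube_estimate[OF f M l])
  finally have "ennreal (m powr (1 / q2)) * epowr (ennreal (1 / m) * (\<integral>\<^sup>+x\<in>Q. ennreal (norm (v x *\<^sub>R riesz_potential lam f x) powr p2) \<partial>lebesgue)) (1 / p2)
     \<le> ennreal (m powr (1 / q2)) * epowr (ennreal (1 / m) * ennreal (cube_const * M powr p2 * m powr (1 - p2 / q2))) (1 / p2)"
    using p2_pos by (intro mult_left_mono epowr_mono) auto
  also have "\<dots> = ennreal (m powr (1 / q2) * (1 / m * (cube_const * M powr p2 * m powr (1 - p2 / q2))) powr (1 / p2))"
    using m cube_const_nonneg by (simp add: epowr_ennreal flip: ennreal_mult)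
  also have "1 / m * (cube_const * M powr p2 * m powr (1 - p2 / q2)) = cube_const * M powr p2 * m powr - (p2 / q2)"
    using m by (simp add: powr_diff powr_minus field_simps)
  also have "(cube_const * M powr p2 * m powr - (p2 / q2)) powr (1 / p2) = cube_const powr (1 / p2) * M * m powr - (1 / q2)"
    using M p2_pos by (simp add: powr_mult powr_powr)
  also have "m powr (1 / q2) * (cube_const powr (1 / p2) * M * m powr - (1 / q2)) = cube_const powr (1 / p2) * M * (m powr - (1 / q2) * m powr (1 / q2))"
    by (simp only: mult_ac)
  also have "m powr - (1 / q2) * m powr (1 / q2) = 1" by (rule powr_minus_cancel[OF m(1)])
  finally show "ennreal (measure lebesgue Q powr (1 / q2)) *
      epowr (ennreal (1 / measure lebesgue Q) * (\<integral>\<^sup>+x\<in>Q. ennreal (norm (v x *\<^sub>R riesz_potential lam f x) powr p2) \<partial>lebesgue)) (1 / p2)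
      \<le> ennreal (cube_const powr (1 / p2) * M)"
    by (simp add: m(2))
qed

text \<open>By Hoelder's inequality on each cube; this makes the Morrey norm finite, so that a real bound for it exists.\<close>

lemma morrey_norm_le_Lnorm:
  assumes "f \<in> weighted_Lspace q1 v"
  shows "morrey_norm p1 q1 v f \<le> Lnorm q1 (\<lambda>x. v x *\<^sub>R f x)"
  unfolding morrey_norm_def
proof (rule SUP_least)
  have [measurable]: "f \<in> borel_measurable lebesgue" using assms by (simp add: weighted_Lspace_def)
  fix Q :: "(real^'d) set" assume "Q \<in> cubes"
  then obtain a l where l: "0 < l" and Q: "Q = cbox a (\<chi> i. a $ i + l)" by (auto simp: cubes_def)
  define m where "m = l ^ CARD('d)"
  have m: "0 < m" "measure lebesgue Q = m" "emeasure lebesgue Q = ennreal m" and Qs [measurable]: "Q \<in> sets lebesgue"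
    using l measure_cube[of l a] emeasure_cube[of l a] by (auto simp: m_def Q)
  define Y where "Y = (\<integral>\<^sup>+x. ennreal (norm (v x *\<^sub>R f x) powr q1) \<partial>lebesgue)"
  have q1_pos: "0 < q1" using p1 q1 by simp
  have "(\<integral>\<^sup>+x\<in>Q. ennreal (norm (v x *\<^sub>R f x) powr p1) \<partial>lebesgue) \<le>
      epowr (\<integral>\<^sup>+x\<in>Q. ennreal (norm (v x *\<^sub>R f x) powr q1) \<partial>lebesgue) (p1 / q1) * ennreal (m powr (1 - p1 / q1))"
    using nn_integral_powr_subset[of "\<lambda>x. ennreal (norm (v x *\<^sub>R f x))" Q m p1 q1] m p1 q1
    by (simp add: epowr_ennreal)
  also have "\<dots> \<le> epowr Y (p1 / q1) * ennreal (m powr (1 - p1 / q1))"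
    unfolding Y_def using p1 q1_pos
    by (intro mult_right_mono epowr_mono nn_integral_mono) (auto simp: indicator_def)
  finally have "ennreal (m powr (1 / q1)) * epowr (ennreal (1 / m) * (\<integral>\<^sup>+x\<in>Q. ennreal (norm (v x *\<^sub>R f x) powr p1) \<partial>lebesgue)) (1 / p1)
     \<le> ennreal (m powr (1 / q1)) * epowr (ennreal (1 / m) * (epowr Y (p1 / q1) * ennreal (m powr (1 - p1 / q1)))) (1 / p1)"
    using p1 by (intro mult_left_mono epowr_mono) auto
  also have "\<dots> = ennreal (m powr (1 / q1) * ((1 / m * m powr (1 - p1 / q1)) powr (1 / p1))) * epowr Y (1 / q1)"
  proof -
    have "ennreal (1 / m) * (epowr Y (p1 / q1) * ennreal (m powr (1 - p1 / q1))) = ennreal (1 / m * m powr (1 - p1 / q1)) * epowr Y (p1 / q1)"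
      using m(1) by (subst ennreal_mult) (auto simp: mult_ac)
    then show ?thesis
      using p1 m(1) by (simp add: epowr_mult epowr_epowr epowr_ennreal ennreal_mult mult.assoc)
  qed
  also have "1 / m * m powr (1 - p1 / q1) = m powr - (p1 / q1)"
    using m(1) by (simp add: powr_diff powr_minus field_simps)
  also have "m powr (1 / q1) * (m powr - (p1 / q1)) powr (1 / p1) = m powr - (1 / q1) * m powr (1 / q1)"
    using p1 by (simp add: powr_powr)
  also have "\<dots> = 1" by (rule powr_minus_cancel[OF m(1)])
  finally show "ennreal (measure lebesgue Q powr (1 / q1)) *
      epowr (ennreal (1 / measure lebesgue Q) * (\<integral>\<^sup>+x\<in>Q. ennreal (norm (v x *\<^sub>R f x) powr p1) \<partial>lebesgue)) (1 / p1)
      \<le> Lnorm q1 (\<lambda>x. v x *\<^sub>R f x)"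
    by (simp add: m(2) Lnorm_def Y_def)
qed

text \<open>The estimates above assume a positive bound \<open>M\<close> for the Morrey norm, which may be zero; hence the passage to
  the limit.\<close>

theorem positive_weight_estimate:
  assumes f: "f \<in> weighted_Lspace q1 v"
  shows "AE x in lebesgue. integrable lebesgue (\<lambda>y. riesz_kernel lam x y *\<^sub>R f y)"
    and "morrey_norm p2 q2 v (riesz_potential lam f) \<le> ennreal (cube_const powr (1 / p2)) * morrey_norm p1 q1 v f"
proof -
  have fm: "f \<in> borel_measurable lebesgue" and "morrey_norm p1 q1 v f < top"
    using f morrey_norm_le_Lnorm[OF f] by (auto simp: weighted_Lspace_def intro: le_less_trans)
  then obtain M where M: "morrey_norm p1 q1 v f = ennreal M" "0 \<le> M"
    by (cases "morrey_norm p1 q1 v f") auto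
  show "AE x in lebesgue. integrable lebesgue (\<lambda>y. riesz_kernel lam x y *\<^sub>R f y)"
    using AE_riesz_int_finite[OF fm, of "M + 1"] M
    by (auto elim!: eventually_mono intro: integrable_riesz_kernel[OF fm] simp: ennreal_leI)
  define C where "C = cube_const powr (1 / p2)"
  have C: "0 \<le> C" by (simp add: C_def)
  have "morrey_norm p2 q2 v (riesz_potential lam f) \<le> ennreal (C * M)"
  proof (rule ennreal_le_epsilon)
    fix \<epsilon> :: real assume \<epsilon>: "0 < \<epsilon>"
    have pos: "0 < M + \<epsilon> / (C + 1)" using M C \<epsilon> by (intro add_nonneg_pos) auto
    have "morrey_norm p2 q2 v (riesz_potential lam f) \<le> ennreal (C * (M + \<epsilon> / (C + 1)))"
      unfolding C_def[symmetric] using M C \<epsilon> pos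
      by (subst C_def, intro morrey_norm_riesz_potential_le fm) (auto intro!: ennreal_leI)
    also have "\<dots> \<le> ennreal (C * M + \<epsilon>)"
    proof (rule ennreal_leI)
      have "C * \<epsilon> / (C + 1) \<le> \<epsilon>" using C \<epsilon> by (simp add: field_simps)
      then show "C * (M + \<epsilon> / (C + 1)) \<le> C * M + \<epsilon>" by (simp add: distrib_left)
    qed
    finally show "morrey_norm p2 q2 v (riesz_potential lam f) \<le> ennreal (C * M) + ennreal \<epsilon>"
      using C M \<epsilon> by simp
  qed
  then show "morrey_norm p2 q2 v (riesz_potential lam f) \<le> ennreal (cube_const powr (1 / p2)) * morrey_norm p1 q1 v f"
    using C M by (simp add: C_def ennreal_mult)
qed

end

section \<open>General weights\<close>

lemma Lnorm_cong_AE: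
  assumes "AE x in lebesgue. norm (f x) = norm (g x)" shows "Lnorm q f = Lnorm q g"
  unfolding Lnorm_def using assms
  by (intro arg_cong[of _ _ "\<lambda>I. epowr I _"] nn_integral_cong_AE) (auto elim!: eventually_mono)

lemma weight_const_cong_AE:
  assumes "AE x in lebesgue. v x = v' x" shows "weight_const s p1 p1' q1 q2 v = weight_const s p1 p1' q1 q2 v'"
proof -
  have "Lnorm q2 (\<lambda>x. v x * indicator Q x) = Lnorm q2 (\<lambda>x. v' x * indicator Q x)"
    "Lnorm p1' (\<lambda>x. inverse (v x) * indicator Q x) = Lnorm p1' (\<lambda>x. inverse (v' x) * indicator Q x)" for Q
    using assms by (auto intro!: Lnorm_cong_AE elim!: eventually_mono)
  then show ?thesis unfolding weight_const_def by simp
qed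

lemma morrey_norm_cong_AE:
  assumes "AE x in lebesgue. v x = v' x" shows "morrey_norm p q v f = morrey_norm p q v' f"
proof -
  have "(\<integral>\<^sup>+x\<in>Q. ennreal (norm (v x *\<^sub>R f x) powr p) \<partial>lebesgue) = (\<integral>\<^sup>+x\<in>Q. ennreal (norm (v' x *\<^sub>R f x) powr p) \<partial>lebesgue)" for Q
    using assms by (intro nn_integral_cong_AE) (auto elim!: eventually_mono)
  then show ?thesis unfolding morrey_norm_def by simp
qed

lemma weighted_Lspace_cong_AE:
  assumes "AE x in lebesgue. v x = v' x" shows "weighted_Lspace q v = weighted_Lspace q v'"
proof -
  have "Lnorm q (\<lambda>x. v x *\<^sub>R f x) = Lnorm q (\<lambda>x. v' x *\<^sub>R f x)" for f :: "_ \<Rightarrow> complex"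
    using assms by (intro Lnorm_cong_AE) (auto elim!: eventually_mono)
  then show ?thesis unfolding weighted_Lspace_def by simp
qed

theorem theorem5p8:
  fixes lam p1 p2 q1 q2 p1' :: real
  assumes "0 < lam" and "lam < real CARD('d::finite)"
    and "1 < p1" and "p1 < real CARD('d) / lam"
    and "p1 \<le> q1" and "q1 < real CARD('d) / lam"
    and "1 / p1 - 1 / p2 = lam / real CARD('d)"
    and "1 / q1 - 1 / q2 = lam / real CARD('d)"
    and "1 / p1' = 1 - 1 / p1"
  shows "\<exists>C :: ennreal \<Rightarrow> real. \<forall>v :: real^'d \<Rightarrow> real.
    weight v \<longrightarrow> weight_const lam p1 p1' q1 q2 v < \<infinity> \<longrightarrow>
    (\<forall>f \<in> weighted_Lspace q1 v.
      (AE x in lebesgue. integrable lebesgue (\<lambda>y. riesz_kernel lam x y *\<^sub>R f y)) \<and>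
      morrey_norm p2 q2 v (riesz_potential lam f)
        \<le> ennreal (C (weight_const lam p1 p1' q1 q2 v)) * morrey_norm p1 q1 v f)"
proof (intro exI allI impI)
  fix v :: "real^'d \<Rightarrow> real"
  assume v: "weight v" and fin: "weight_const lam p1 p1' q1 q2 v < \<infinity>"
  define k where "k = weight_const lam p1 p1' q1 q2 v"
  define v' where "v' x = (if 0 < v x then v x else 1)" for x
  have eq: "AE x in lebesgue. v x = v' x"
    using v by (auto simp: weight_def v'_def elim!: eventually_mono)
  \<comment> \<open>Adding \<open>1\<close> makes the bound for the weight positive without a case distinction.\<close>
  interpret fractional_weight lam p1 p2 q1 q2 p1' v' "enn2real k + 1"
  proof
    have [measurable]: "v \<in> borel_measurable lebesgue" using v by (simp add: weight_def)
    show "v' \<in> borel_measurable lebesgue" unfolding v'_def by measurable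
    show "weight_const lam p1 p1' q1 q2 v' \<le> ennreal (enn2real k + 1)"
      using fin unfolding weight_const_cong_AE[OF eq, symmetric] k_def[symmetric]
      by (cases k) (auto intro: ennreal_leI)
  qed (use assms in \<open>auto simp: v'_def add_nonneg_pos\<close>)
  show "\<forall>f \<in> weighted_Lspace q1 v.
      (AE x in lebesgue. integrable lebesgue (\<lambda>y. riesz_kernel lam x y *\<^sub>R f y)) \<and>
      morrey_norm p2 q2 v (riesz_potential lam f)
        \<le> ennreal ((\<lambda>k. fractional_weight.cube_const TYPE('d) lam p1 p2 q1 q2 p1' (enn2real k + 1) powr (1 / p2))
          (weight_const lam p1 p1' q1 q2 v)) * morrey_norm p1 q1 v f"
    using positive_weight_estimate
    unfolding weighted_Lspace_cong_AE[OF eq] morrey_norm_cong_AE[OF eq] k_def by auto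
qed

end
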